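(* The problem of listing the maximal connected edge-induced directed acyclic subgraphs of a directed graph $G$ is proximity searchable, and it can be solved (every solution output exactly once) with $O(m^3)$ time delay.
   Context: $G$ is a directed graph with $m$ edges (isolated vertices disregarded). A maximal connected edge-induced directed acyclic subgraph is a set $F\subseteq E(G)$ such that the directed graph with edge set $F$ and vertex set the endpoints of $F$ is acyclic and (weakly) connected, and no $F'\supsetneq F$ has both properties. A listing problem with universe $\mathcal{U}$ (here $E(G)$) and set $\mathcal{S}$ of solutions to list is proximity searchable if there exist $\tilde{\cap}:\mathcal{S}\times\mathcal{S}\to 2^{\mathcal{U}}$ and $\mathrm{neighbors}:\mathcal{S}\to 2^{\mathcal{S}}$ such that one solution can be found in time polynomial in $|\mathcal{U}|$, $\mathrm{neighbors}$ is computable in time polynomial in $|\mathcal{U}|$, and for any two distinct $S,S^*\in\mathcal{S}$ some $S'\in\mathrm{neighbors}(S)$ satisfies $|S'\,\tilde{\cap}\,S^*|>|S\,\tilde{\cap}\,S^*|$. Delay is the maximum time before the first output, between consecutive outputs, and after the last output. *)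

theory Defs
  imports Complex_Main "HOL-Library.Landau_Symbols"
begin

section \<open>Model of computation\<close>

text \<open>
  A unit-cost random access machine with structured control flow. Its memory consists of
  registers and of unbounded arrays, all numbered and holding natural numbers. Since \<open>Inc\<close> is the
  only arithmetic operation that increases a value, after \<open>t\<close> steps no value exceeds the maximum of
  the numbers in the input and in the program by more than \<open>t\<close>; charging one unit
  per instruction therefore hides no arithmetic on long numbers, and a standard word RAM
  simulates these programs with constant overhead.
\<close>

type_synonym reg = nat
type_synonym arr = nat

datatype instr =
    Const reg nat
  | Move reg reg
  | Inc reg
  | Dec reg
  | Load reg arr reg
  | Store arr reg reg
  | Put reg
  | EndSol

datatype test = Equal reg reg | Less reg reg

datatype prog =
    Do instr
  | Seq prog prog
  | If test prog prog
  | While test prog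

record state =
  regs :: "reg \<Rightarrow> nat"
  arrs :: "arr \<Rightarrow> nat \<Rightarrow> nat"

text \<open>
  Every step takes one unit of time and contributes exactly one event. \<open>Out n\<close> appends \<open>n\<close> to
  the object being output, and \<open>Sep\<close> completes that object.
\<close>

datatype event = Tick | Out nat | Sep

fun effect :: "instr \<Rightarrow> state \<Rightarrow> state" where
  "effect (Const x n) s = s\<lparr>regs := (regs s)(x := n)\<rparr>"
| "effect (Move x y) s = s\<lparr>regs := (regs s)(x := regs s y)\<rparr>"
| "effect (Inc x) s = s\<lparr>regs := (regs s)(x := regs s x + 1)\<rparr>"
| "effect (Dec x) s = s\<lparr>regs := (regs s)(x := regs s x - 1)\<rparr>"
| "effect (Load x a y) s = s\<lparr>regs := (regs s)(x := arrs s a (regs s y))\<rparr>"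
| "effect (Store a x y) s = s\<lparr>arrs := (arrs s)(a := (arrs s a)(regs s x := regs s y))\<rparr>"
| "effect (Put x) s = s"
| "effect EndSol s = s"

fun event_of :: "instr \<Rightarrow> state \<Rightarrow> event" where
  "event_of (Put x) s = Out (regs s x)"
| "event_of EndSol s = Sep"
| "event_of _ s = Tick"

fun holds :: "test \<Rightarrow> state \<Rightarrow> bool" where
  "holds (Equal x y) s \<longleftrightarrow> regs s x = regs s y"
| "holds (Less x y) s \<longleftrightarrow> regs s x < regs s y"

text \<open>\<open>exec p s tr t\<close>: started in \<open>s\<close>, the program \<open>p\<close> halts in \<open>t\<close> with trace \<open>tr\<close>.\<close>

inductive exec :: "prog \<Rightarrow> state \<Rightarrow> event list \<Rightarrow> state \<Rightarrow> bool" where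
  Do: "exec (Do i) s [event_of i s] (effect i s)"
| Seq: "exec p s tr s' \<Longrightarrow> exec q s' tr' s'' \<Longrightarrow> exec (Seq p q) s (tr @ tr') s''"
| IfTrue: "holds b s \<Longrightarrow> exec p s tr s' \<Longrightarrow> exec (If b p q) s (Tick # tr) s'"
| IfFalse: "\<not> holds b s \<Longrightarrow> exec q s tr s' \<Longrightarrow> exec (If b p q) s (Tick # tr) s'"
| WhileTrue: "holds b s \<Longrightarrow> exec p s tr s' \<Longrightarrow> exec (While b p) s' tr' s'' \<Longrightarrow>
    exec (While b p) s (Tick # tr @ tr') s''"
| WhileFalse: "\<not> holds b s \<Longrightarrow> exec (While b p) s [Tick] s"

text \<open>Runs are unique, so the existential statements about runs below speak about the run.\<close>

lemma exec_deterministic: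
  "exec p s tr t \<Longrightarrow> exec p s tr' t' \<Longrightarrow> tr' = tr \<and> t' = t"
proof (induction arbitrary: tr' t' rule: exec.induct)
  case Do
  from Do.prems show ?case by cases auto
next
  case Seq
  from Seq.prems show ?case by cases (use Seq.IH in blast)
next
  case IfTrue
  from IfTrue.prems show ?case by cases (use IfTrue.IH IfTrue.hyps in blast)+
next
  case IfFalse
  from IfFalse.prems show ?case by cases (use IfFalse.IH IfFalse.hyps in blast)+
next
  case WhileTrue
  from WhileTrue.prems show ?case by cases (use WhileTrue.IH WhileTrue.hyps in blast)+
next
  case WhileFalse
  from WhileFalse.prems show ?case by cases (use WhileFalse.hyps in blast)+
qed

text \<open>
  The input is a list of lists: the \<open>k\<close>-th list is stored in array \<open>k\<close> and its length in
  register \<open>k\<close>. The rest of the memory is initially zero.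
\<close>

definition init :: "nat list list \<Rightarrow> state" where
  "init inp =
    \<lparr>regs = (\<lambda>k. if k < length inp then length (inp ! k) else 0),
     arrs = (\<lambda>k j. if k < length inp \<and> j < length (inp ! k) then inp ! k ! j else 0)\<rparr>"

definition outputs :: "event list \<Rightarrow> nat list list \<Rightarrow> bool" where
  "outputs tr xss \<longleftrightarrow> filter (\<lambda>e. e \<noteq> Tick) tr = concat (map (\<lambda>xs. map Out xs @ [Sep]) xss)"

text \<open>
  \<open>gaps 0 tr\<close> lists the times before the first output, between consecutive outputs, and
  after the last output; an output takes place when it is completed.
\<close>

fun gaps :: "nat \<Rightarrow> event list \<Rightarrow> nat list" where
  "gaps n [] = [n]"
| "gaps n (Sep # tr) = Suc n # gaps 0 tr"
| "gaps n (Tick # tr) = gaps (Suc n) tr"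
| "gaps n (Out k # tr) = gaps (Suc n) tr"

definition delay :: "event list \<Rightarrow> nat" where
  "delay tr = Max (set (gaps 0 tr))"

section \<open>Listing problems\<close>

text \<open>
  \<open>elems i\<close> enumerates the universe of the instance \<open>i\<close> without repetition; solutions are
  subsets of the universe, read and written as lists of positions in \<open>elems i\<close>.
\<close>

record ('i, 'u) listing_problem =
  instances :: "'i set"
  input :: "'i \<Rightarrow> nat list list"
  elems :: "'i \<Rightarrow> 'u list"
  solutions :: "'i \<Rightarrow> 'u set set"

definition universe :: "('i, 'u) listing_problem \<Rightarrow> 'i \<Rightarrow> 'u set" where
  "universe P i = set (elems P i)"

definition encodes :: "('i, 'u) listing_problem \<Rightarrow> 'i \<Rightarrow> nat list \<Rightarrow> 'u set \<Rightarrow> bool" where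
  "encodes P i xs S \<longleftrightarrow>
    distinct xs \<and> set xs \<subseteq> {..<length (elems P i)} \<and> S = (\<lambda>k. elems P i ! k) ` set xs"

definition polynomially_bounded :: "(nat \<Rightarrow> nat) \<Rightarrow> bool" where
  "polynomially_bounded T \<longleftrightarrow> (\<exists>k. (\<lambda>n. real (T n)) \<in> O(\<lambda>n. real n ^ k))"

definition solution_findable :: "('i, 'u) listing_problem \<Rightarrow> bool" where
  "solution_findable P \<longleftrightarrow>
    (\<exists>p T. polynomially_bounded T \<and>
      (\<forall>i \<in> instances P. \<exists>tr t xs S.
        exec p (init (input P i)) tr t \<and> length tr \<le> T (card (universe P i)) \<and>
        outputs tr [xs] \<and> encodes P i xs S \<and> S \<in> solutions P i))"

text \<open>The solution is passed to the program in an additional input array. Its neighbors may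
  be output repeatedly.\<close>

definition neighbors_computable ::
    "('i, 'u) listing_problem \<Rightarrow> ('i \<Rightarrow> 'u set \<Rightarrow> 'u set set) \<Rightarrow> bool" where
  "neighbors_computable P neighbors \<longleftrightarrow>
    (\<exists>p T. polynomially_bounded T \<and>
      (\<forall>i \<in> instances P. \<forall>S \<in> solutions P i. \<forall>xs. encodes P i xs S \<longrightarrow>
        (\<exists>tr t yss Ss.
          exec p (init (input P i @ [xs])) tr t \<and> length tr \<le> T (card (universe P i)) \<and>
          outputs tr yss \<and> list_all2 (encodes P i) yss Ss \<and> set Ss = neighbors i S)))"

definition proximity_searchable :: "('i, 'u) listing_problem \<Rightarrow> bool" where
  "proximity_searchable P \<longleftrightarrow>
    solution_findable P \<and>
    (\<exists>(prox :: 'i \<Rightarrow> 'u set \<Rightarrow> 'u set \<Rightarrow> 'u set) neighbors.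
      (\<forall>i \<in> instances P. \<forall>S \<in> solutions P i. \<forall>S' \<in> solutions P i.
        prox i S S' \<subseteq> universe P i) \<and>
      (\<forall>i \<in> instances P. \<forall>S \<in> solutions P i. neighbors i S \<subseteq> solutions P i) \<and>
      neighbors_computable P neighbors \<and>
      (\<forall>i \<in> instances P. \<forall>S \<in> solutions P i. \<forall>S' \<in> solutions P i. S \<noteq> S' \<longrightarrow>
        (\<exists>S'' \<in> neighbors i S. card (prox i S'' S') > card (prox i S S'))))"

definition listable_with_delay :: "('i, 'u) listing_problem \<Rightarrow> (nat \<Rightarrow> real) \<Rightarrow> bool" where
  "listable_with_delay P f \<longleftrightarrow>
    (\<exists>p T. (\<lambda>n. real (T n)) \<in> O(f) \<and>
      (\<forall>i \<in> instances P. \<exists>tr t xss Ss.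
        exec p (init (input P i)) tr t \<and> delay tr \<le> T (card (universe P i)) \<and>
        outputs tr xss \<and> list_all2 (encodes P i) xss Ss \<and>
        distinct Ss \<and> set Ss = solutions P i))"

section \<open>Maximal connected edge-induced directed acyclic subgraphs\<close>

text \<open>The subgraph induced by the edge set \<open>F\<close> has the vertex set \<^term>\<open>Field F\<close>.\<close>

definition weakly_connected :: "('v \<times> 'v) set \<Rightarrow> bool" where
  "weakly_connected F \<longleftrightarrow> (\<forall>u \<in> Field F. \<forall>v \<in> Field F. (u, v) \<in> (F \<union> F\<inverse>)\<^sup>*)"

definition connected_dag :: "('v \<times> 'v) set \<Rightarrow> bool" where
  "connected_dag F \<longleftrightarrow> acyclic F \<and> weakly_connected F"

definition maximal_connected_dags :: "('v \<times> 'v) set \<Rightarrow> ('v \<times> 'v) set set" where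
  "maximal_connected_dags E =
    {F. F \<subseteq> E \<and> connected_dag F \<and> \<not> (\<exists>F'. F \<subset> F' \<and> F' \<subseteq> E \<and> connected_dag F')}"

text \<open>A graph is given by an arbitrary enumeration of its edges, stored as the array of their tails
  and the array of their heads. The vertex names are arbitrary natural numbers.\<close>

definition maximal_connected_dag_problem ::
    "((nat \<times> nat) list, nat \<times> nat) listing_problem" where
  "maximal_connected_dag_problem =
    \<lparr>instances = {es. distinct es},
     input = (\<lambda>es. [map fst es, map snd es]),
     elems = (\<lambda>es. es),
     solutions = (\<lambda>es. maximal_connected_dags (set es))\<rparr>"

end

theory Submission imports Defs begin

text \<open>
  A connected acyclic edge set \<open>F\<close> can be built up edge by edge so that it stays connected and every
  added edge \<open>(u, v)\<close> has no other edge so far entering \<open>u\<close>, or none so far leaving \<open>v\<close>. The proximity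
  of \<open>S\<close> to \<open>F\<close> is the longest prefix of this order that lies in \<open>S\<close>. If \<open>(u, v)\<close> is the edge of \<open>F\<close> after
  this prefix, remove from \<open>S\<close> all edges entering \<open>u\<close>, respectively all edges leaving \<open>v\<close>: the prefix
  survives, and \<open>(u, v)\<close> closes no cycle. Hence a maximal solution that contains the component of
  \<open>(u, v)\<close> in what is left is closer to \<open>F\<close>. This gives two neighbors for each edge.

  The chosen edges are kept in an order in which every path is increasing. Then one pass over this
  list finds all vertices reachable from \<open>v\<close>, so testing and adding an edge takes time \<open>O(m)\<close>. An
  edge that would close a cycle never has to be considered again, so a solution is completed after
  \<open>m\<close> tests, and all neighbors are computed in time \<open>O(m\<^sup>3)\<close>. Breadth-first search along neighbors,
  with a trie to recognize known solutions, outputs one solution per expansion.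
\<close>

section \<open>Connected acyclic edge sets\<close>

text \<open>Subsets of a connected acyclic set need not be connected, so an arbitrary enumeration of
  \<open>F\<close> does not serve as the order. A prefix extended by its next edge has to be
  connected, or completing the component of that edge would not recover it; and the next edge has to
  be made addable to \<open>S\<close> by deleting only edges outside the prefix. A cycle through
  \<open>(u, v)\<close> both enters \<open>u\<close> and leaves \<open>v\<close>, so deleting one of
  these two groups destroys all such cycles at once. Which group the prefix avoids depends on the
  unknown \<open>F\<close>, hence both deletions are tried.

  Vertex names are arbitrary numbers, so arrays indexed by vertices can be cleared only at the
  endpoints of edges. This keeps every loop inside an expansion at exactly one round per edge, and
  the exponent 3 becomes the nesting depth of these loops. The search loop is the only one with
  another number of rounds: one per solution, possibly exponentially many. Its total time stays
  unbounded by a polynomial; only the time between two rounds matters.\<close>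

lemma weakly_connected_empty [simp]: "weakly_connected {}"
  by (simp add: weakly_connected_def)

lemma weakly_connectedI:
  assumes "\<And>v. v \<in> Field F \<Longrightarrow> (r, v) \<in> (F \<union> F\<inverse>)\<^sup>*"
  shows "weakly_connected F"
proof -
  have "sym ((F \<union> F\<inverse>)\<^sup>*)"
    by (intro sym_rtrancl) (auto simp: sym_def)
  then show ?thesis
    unfolding weakly_connected_def using assms by (meson rtrancl_trans symD)
qed

lemma weakly_connected_insert:
  assumes "weakly_connected F" and "F = {} \<or> fst e \<in> Field F \<or> snd e \<in> Field F"
  shows "weakly_connected (insert e F)"
proof -
  obtain u v where e: "e = (u, v)" by fastforce
  let ?G = "insert e F"
  obtain r where r: "r \<in> {u, v}" and F: "F = {} \<or> r \<in> Field F"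
    using assms(2) e by auto
  have mono: "(F \<union> F\<inverse>)\<^sup>* \<subseteq> (?G \<union> ?G\<inverse>)\<^sup>*"
    by (intro rtrancl_mono) auto
  have "(u, v) \<in> (?G \<union> ?G\<inverse>)\<^sup>*" "(v, u) \<in> (?G \<union> ?G\<inverse>)\<^sup>*"
    by (auto simp: e)
  moreover have "(r, w) \<in> (?G \<union> ?G\<inverse>)\<^sup>*" if "w \<in> Field F" for w
    using that F assms(1) mono unfolding weakly_connected_def by (auto simp: Field_def)
  ultimately show ?thesis
    using r by (intro weakly_connectedI[of _ r]) (auto simp: e Field_insert)
qed

text \<open>If no edge of \<open>B - A\<close> touched a vertex of \<open>A\<close>, an undirected
  walk in \<open>B\<close> starting in \<open>Field A\<close> could never leave it. This is how
  connectivity drives every growing argument below.\<close>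

lemma weakly_connected_attached_edge:
  assumes "weakly_connected B" "A \<subset> B" "A \<noteq> {}"
  obtains f where "f \<in> B - A" "fst f \<in> Field A \<or> snd f \<in> Field A"
proof (rule ccontr)
  assume "\<not> thesis"
  then have no: "fst f \<notin> Field A \<and> snd f \<notin> Field A" if "f \<in> B - A" for f
    using that \<open>\<And>f. f \<in> B - A \<Longrightarrow> fst f \<in> Field A \<or> snd f \<in> Field A \<Longrightarrow> thesis\<close> by blast
  obtain x where x: "x \<in> Field A" using \<open>A \<noteq> {}\<close> by (auto simp: Field_def)
  obtain g where g: "g \<in> B - A" using \<open>A \<subset> B\<close> by blast
  have "y \<in> Field A" if "(x, y) \<in> (B \<union> B\<inverse>)\<^sup>*" for y
    using that
  proof (induction rule: rtrancl_induct)
    case base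
    show ?case by (fact x)
  next
    case (step y z)
    then have "(y, z) \<in> A \<or> (z, y) \<in> A" using no by fastforce
    then show ?case by (auto simp: Field_def)
  qed
  moreover have "x \<in> Field B" using x mono_Field[of A B] \<open>A \<subset> B\<close> by blast
  moreover have "fst g \<in> Field B" using g by (cases g) (auto simp: Field_def)
  ultimately have "fst g \<in> Field A"
    using assms(1) unfolding weakly_connected_def by blast
  then show False using no g by blast
qed

lemma acyclic_no_loop: "acyclic F \<Longrightarrow> (x, x) \<notin> F"
  by (auto simp: acyclic_def)

section \<open>Sources, sinks and peripheral edges\<close>

lemma finite_acyclic_has_source_edge:
  assumes "finite D" "acyclic D" "D \<noteq> {}"
  obtains s x where "(s, x) \<in> D" "s \<notin> Range D"
proof -
  have "wf D" using assms by (simp add: finite_acyclic_wf)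
  moreover obtain a where "a \<in> Domain D" using assms(3) by auto
  ultimately obtain s where "s \<in> Domain D" "\<And>y. (y, s) \<in> D \<Longrightarrow> y \<notin> Domain D"
    by (meson wfE_min)
  then show thesis using that by blast
qed

lemma finite_acyclic_has_sink_edge:
  assumes "finite D" "acyclic D" "D \<noteq> {}"
  obtains t x where "(x, t) \<in> D" "t \<notin> Domain D"
proof -
  have "finite (D\<inverse>)" "acyclic (D\<inverse>)" "D\<inverse> \<noteq> {}" using assms by (auto simp: acyclic_converse)
  then show thesis
    by (rule finite_acyclic_has_source_edge) (use that in auto)
qed

text \<open>A cycle through \<open>e\<close> enters its tail and leaves its head. Here one of the
  two is impossible for a reason visible at a single vertex, which deleting edges at that vertex can
  imitate in another set.\<close>

definition peripheral :: "('v \<times> 'v) set \<Rightarrow> 'v \<times> 'v \<Rightarrow> bool" where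
  "peripheral F e \<longleftrightarrow> fst e \<notin> Range F \<or> snd e \<notin> Domain F"

text \<open>Among all peripheral edges \<open>e\<close> and connected \<open>C \<subseteq> F - {e}\<close>, one with \<open>C\<close> as large as possible
  has \<open>C = F - {e}\<close>: otherwise the other edges of \<open>F - {e}\<close> contain a peripheral edge whose removal
  leaves \<open>C\<close> attached to \<open>e\<close>.\<close>

lemma connected_dag_removable_edge:
  assumes fin: "finite F" and "connected_dag F" and "F \<noteq> {}"
  obtains e where "e \<in> F" "peripheral F e" "weakly_connected (F - {e})"
proof -
  have ac: "acyclic F" and wc: "weakly_connected F"
    using assms(2) by (auto simp: connected_dag_def)
  define X where "X = {(e, C). e \<in> F \<and> peripheral F e \<and> C \<subseteq> F - {e} \<and> weakly_connected C}"
  have "X \<subseteq> F \<times> Pow F" by (auto simp: X_def)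
  then have finX: "finite X" using fin by (meson finite_Pow_iff finite_SigmaI finite_subset)
  \<comment> \<open>A source edge together with the empty set shows that \<open>X\<close> is
    inhabited.\<close>
  obtain s x where "(s, x) \<in> F" "s \<notin> Range F"
    using finite_acyclic_has_source_edge[OF fin ac assms(3)] .
  then have "((s, x), {}) \<in> X" by (auto simp: X_def peripheral_def)
  then have neX: "X \<noteq> {}" by blast
  define n where "n = Max ((card \<circ> snd) ` X)"
  have "n \<in> (card \<circ> snd) ` X" unfolding n_def using finX neX by (intro Max_in) auto
  then obtain eC where "eC \<in> X" and n: "n = card (snd eC)" by auto
  have max': "card (snd y) \<le> card (snd eC)" if "y \<in> X" for y
    using finX that Max_ge[of "(card \<circ> snd) ` X" "card (snd y)"] by (force simp: n_def n[symmetric])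
  obtain e C where eC: "eC = (e, C)" by fastforce
  have e: "e \<in> F" "peripheral F e" and C: "C \<subseteq> F - {e}" "weakly_connected C"
    using \<open>eC \<in> X\<close> by (auto simp: X_def eC)
  have max: "card C' \<le> card C" if "e' \<in> F" "peripheral F e'" "C' \<subseteq> F - {e'}" "weakly_connected C'"
    for e' C' using max'[of "(e', C')"] that eC by (simp add: X_def)
  have finC: "finite C" using C fin by (meson finite_Diff finite_subset)
  have no_larger: "\<not> weakly_connected (insert f C)" if "f \<in> F - {e} - C" for f
    using max[of e "insert f C"] e C that finC by auto
  define D where "D = F - {e} - C"
  have "D = {}"
  proof (rule ccontr)
    assume "D \<noteq> {}"
    then have "C \<noteq> {}"
      using no_larger weakly_connected_insert[OF C(2)] by (fastforce simp: D_def)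
    have "C \<subset> F" using C e by blast
    obtain f where f: "f \<in> F - C" "fst f \<in> Field C \<or> snd f \<in> Field C"
      using weakly_connected_attached_edge[OF wc \<open>C \<subset> F\<close> \<open>C \<noteq> {}\<close>] .
    then have "f = e"
      using no_larger[of f] weakly_connected_insert[OF C(2)] by blast
    have wce: "weakly_connected (insert e C)"
      using f weakly_connected_insert[OF C(2)] \<open>f = e\<close> by blast
    have disj: "fst g \<notin> Field C \<and> snd g \<notin> Field C" if "g \<in> D" for g
      using that no_larger[of g] weakly_connected_insert[OF C(2), of g] unfolding D_def by blast
    have FD: "F = D \<union> C \<union> {e}" using e C by (auto simp: D_def)
    \<comment> \<open>One endpoint of \<open>e\<close> lies in \<open>Field C\<close>, and
      \<open>z\<close> stands for the other. Edges of \<open>D\<close> avoid \<open>Field C\<close>,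
      so \<open>z\<close> is the only vertex at which \<open>D\<close> can meet the rest of
      \<open>F\<close>.\<close>
    obtain z where z: "fst e \<in> insert z (Field C)" "snd e \<in> insert z (Field C)"
    proof (cases "fst e \<in> Field C")
      case True
      then show thesis using that[of "snd e"] by simp
    next
      case False
      then show thesis using that[of "fst e"] f \<open>f = e\<close> by simp
    qed
    have "finite D" "acyclic D"
      using fin ac by (auto simp: D_def intro: acyclic_subset)
    obtain s x where s: "(s, x) \<in> D" "s \<notin> Range D"
      using finite_acyclic_has_source_edge[OF \<open>finite D\<close> \<open>acyclic D\<close> \<open>D \<noteq> {}\<close>] .
    obtain t y where t: "(y, t) \<in> D" "t \<notin> Domain D"
      using finite_acyclic_has_sink_edge[OF \<open>finite D\<close> \<open>acyclic D\<close> \<open>D \<noteq> {}\<close>] .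
    \<comment> \<open>A source and a sink of \<open>D\<close> differ, so one of them is not
      \<open>z\<close> and remains a source or a sink in all of \<open>F\<close>.\<close>
    have "s \<noteq> t" using s t by blast
    then consider "s \<noteq> z" | "t \<noteq> z" by blast
    then obtain g where g: "g \<in> D" "peripheral F g"
    proof cases
      case 1
      have "s \<notin> Field C" using disj s by fastforce
      then have "s \<notin> Range F"
        using 1 s z by (auto simp: FD Field_def)
      then show thesis using that[of "(s, x)"] s by (simp add: peripheral_def)
    next
      case 2
      have "t \<notin> Field C" using disj t by fastforce
      then have "t \<notin> Domain F"
        using 2 t z by (auto simp: FD Field_def)
      then show thesis using that[of "(y, t)"] t by (simp add: peripheral_def)
    qed
    then have "card (insert e C) \<le> card C"
      using wce C e by (intro max[of g]) (auto simp: D_def)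
    moreover have "e \<notin> C" using C by blast
    ultimately show False using finC by simp
  qed
  then have "C = F - {e}" using C by (auto simp: D_def)
  then show thesis using that e C by blast
qed

definition connected_order :: "('v \<times> 'v) list \<Rightarrow> bool" where
  "connected_order es \<longleftrightarrow> (\<forall>k < length es.
     weakly_connected (set (take (Suc k) es)) \<and> peripheral (set (take (Suc k) es)) (es ! k))"

text \<open>Built from the end: a removable edge becomes the last one, and what remains is again
  connected and acyclic.\<close>

lemma connected_order_exists:
  assumes "finite F" "connected_dag F"
  shows "\<exists>es. set es = F \<and> distinct es \<and> connected_order es"
  using assms
proof (induction "card F" arbitrary: F)
  case 0
  then show ?case by (auto simp: connected_order_def)
next
  case (Suc n)
  then have "F \<noteq> {}" by auto
  obtain e where e: "e \<in> F" "peripheral F e" "weakly_connected (F - {e})"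
    using connected_dag_removable_edge[OF Suc.prems \<open>F \<noteq> {}\<close>] .
  have "connected_dag (F - {e})"
    using e Suc.prems by (auto simp: connected_dag_def intro: acyclic_subset)
  moreover have "n = card (F - {e})" "finite (F - {e})" using Suc e by auto
  ultimately obtain es where es: "set es = F - {e}" "distinct es" "connected_order es"
    using Suc.hyps(1) by blast
  have "weakly_connected F" using Suc.prems by (simp add: connected_dag_def)
  moreover have "set (es @ [e]) = F" using es e by auto
  ultimately have "connected_order (es @ [e])"
    using es(3) e(2) by (auto simp: connected_order_def less_Suc_eq nth_append)
  then show ?case using \<open>set (es @ [e]) = F\<close> es by (intro exI[of _ "es @ [e]"]) auto
qed

section \<open>Growing a connected acyclic edge set\<close>

text \<open>A list of edges in which every path appears in order.\<close>

definition path_ordered :: "('v \<times> 'v) list \<Rightarrow> bool" where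
  "path_ordered L \<longleftrightarrow> sorted_wrt (\<lambda>e f. snd f \<noteq> fst e) L \<and> (\<forall>e \<in> set L. snd e \<noteq> fst e)"

definition reach :: "('v \<times> 'v) list \<Rightarrow> 'v \<Rightarrow> 'v set" where
  "reach L v = foldl (\<lambda>M e. if fst e \<in> M then insert (snd e) M else M) {v} L"

lemma path_ordered_Nil [simp]: "path_ordered []"
  by (simp add: path_ordered_def)

section \<open>Reachability along a path-ordered list\<close>

lemma reach_snoc:
  "reach (L @ [e]) v = (if fst e \<in> reach L v then insert (snd e) (reach L v) else reach L v)"
  by (simp add: reach_def)

lemma path_ordered_snocD:
  assumes "path_ordered (L @ [e])"
  shows "path_ordered L" "snd e \<notin> Domain (set L)" "snd e \<noteq> fst e"
  using assms by (auto simp: path_ordered_def sorted_wrt_append)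

text \<open>No edge of a path-ordered list leaves the head of its last edge, so a path can use that
  edge only at its very end. Hence a single pass misses nothing.\<close>

lemma reach_eq: "path_ordered L \<Longrightarrow> reach L v = (set L)\<^sup>* `` {v}"
proof (induction L rule: rev_induct)
  case Nil
  then show ?case by (simp add: reach_def)
next
  case (snoc e L)
  note * = path_ordered_snocD[OF snoc.prems]
  have "(snd e, y) \<in> (set L)\<^sup>* \<longleftrightarrow> y = snd e" for y
    using *(2) by (auto elim: converse_rtranclE)
  moreover have "(insert e (set L))\<^sup>* =
      (set L)\<^sup>* \<union> {(x, y). (x, fst e) \<in> (set L)\<^sup>* \<and> (snd e, y) \<in> (set L)\<^sup>*}"
    using rtrancl_insert[of "fst e" "snd e" "set L"] by simp
  ultimately show ?case using snoc.IH *(1) by (auto simp: reach_snoc)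
qed

lemma path_ordered_acyclic: "path_ordered L \<Longrightarrow> acyclic (set L)"
proof (induction L rule: rev_induct)
  case Nil
  then show ?case by (simp add: acyclic_def)
next
  case (snoc e L)
  note * = path_ordered_snocD[OF snoc.prems]
  have "(snd e, fst e) \<notin> (set L)\<^sup>*"
    using *(2,3) by (auto elim: converse_rtranclE)
  then show ?case
    using snoc.IH *(1) acyclic_insert[of "fst e" "snd e" "set L"] by simp
qed

text \<open>A search state consists of the chosen edges, in path order, and the rejected edges. To keep
  the path order, the edges whose tails are reachable from the head of a new edge move behind it.\<close>

type_synonym 'v search_state = "('v \<times> 'v) list \<times> ('v \<times> 'v) set"

fun try_edge :: "'v \<times> 'v \<Rightarrow> 'v search_state \<Rightarrow> 'v search_state" where
  "try_edge e (L, R) =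
    (let M = reach L (snd e) in
     if fst e \<in> M then (L, insert e R)
     else (filter (\<lambda>f. fst f \<notin> M) L @ e # filter (\<lambda>f. fst f \<in> M) L, R))"

declare try_edge.simps [simp del]

fun eligible :: "('v \<times> 'v) set \<Rightarrow> 'v search_state \<Rightarrow> 'v \<times> 'v \<Rightarrow> bool" where
  "eligible A (L, R) e \<longleftrightarrow> e \<in> A \<and> e \<notin> set L \<union> R \<and>
     (L = [] \<or> fst e \<in> Field (set L) \<or> snd e \<in> Field (set L))"

text \<open>The last eligible edge, not the first: a scan that overwrites its result at every hit
  ends with it and needs no early exit from the loop.\<close>

definition grow_step :: "('v \<times> 'v) list \<Rightarrow> ('v \<times> 'v) set \<Rightarrow> 'v search_state \<Rightarrow> 'v search_state" where
  "grow_step es A st =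
    (if filter (eligible A st) es = [] then st
     else try_edge (last (filter (eligible A st) es)) st)"

text \<open>The number of rounds is fixed in advance, as a counting loop demands; surplus rounds
  leave the state alone.\<close>

definition grow :: "('v \<times> 'v) list \<Rightarrow> ('v \<times> 'v) set \<Rightarrow> 'v search_state \<Rightarrow> 'v search_state" where
  "grow es A st = (grow_step es A ^^ length es) st"

fun grow_inv :: "('v \<times> 'v) list \<Rightarrow> 'v search_state \<Rightarrow> bool" where
  "grow_inv es (L, R) \<longleftrightarrow> path_ordered L \<and> distinct L \<and> set L \<subseteq> set es \<and>
     weakly_connected (set L) \<and> R \<subseteq> set es \<and>
     (\<forall>e \<in> R. e \<notin> set L \<and> \<not> acyclic (insert e (set L)))"

section \<open>Invariants of growing\<close>

lemma set_try_edge: "set (fst (try_edge e st)) =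
    (if fst e \<in> reach (fst st) (snd e) then set (fst st) else insert e (set (fst st)))"
  by (cases st) (auto simp: try_edge.simps Let_def)

lemma rejected_try_edge: "snd (try_edge e st) =
    (if fst e \<in> reach (fst st) (snd e) then insert e (snd st) else snd st)"
  by (cases st) (auto simp: try_edge.simps Let_def)

lemma decided_try_edge: "set (fst (try_edge e st)) \<union> snd (try_edge e st) =
    insert e (set (fst st) \<union> snd st)"
  by (simp add: set_try_edge rejected_try_edge)

lemma fst_mem_reach_iff:
  assumes "path_ordered L"
  shows "fst e \<in> reach L (snd e) \<longleftrightarrow> \<not> acyclic (insert e (set L))"
  using acyclic_insert[of "fst e" "snd e" "set L"] path_ordered_acyclic[OF assms]
  by (simp add: reach_eq[OF assms])

text \<open>\<open>reach L (snd e)\<close> is closed under the edges of \<open>L\<close>. So the new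
  edge and those moved behind it have their heads in this set, while the new edge and those before
  it have their tails outside. No edge can therefore end where one further to the front
  starts.\<close>

lemma path_ordered_try_edge:
  assumes "path_ordered L"
  shows "path_ordered (fst (try_edge e (L, R)))"
proof (cases "fst e \<in> reach L (snd e)")
  case True
  then show ?thesis using assms by (simp add: try_edge.simps Let_def)
next
  case False
  let ?M = "reach L (snd e)"
  have "snd e \<in> ?M" by (simp add: reach_eq[OF assms])
  moreover have "snd f \<in> ?M" if "f \<in> set L" "fst f \<in> ?M" for f
    using that by (auto simp: reach_eq[OF assms] intro: rtrancl_into_rtrancl)
  ultimately show ?thesis
    using assms False
    by (auto simp: try_edge.simps Let_def path_ordered_def sorted_wrt_append intro!: sorted_wrt_filter)
qed

lemma grow_inv_try_edge:
  assumes inv: "grow_inv es st" and e: "e \<in> set es" "e \<notin> set (fst st)"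
    "fst st = [] \<or> fst e \<in> Field (set (fst st)) \<or> snd e \<in> Field (set (fst st))"
  shows "grow_inv es (try_edge e st)"
proof -
  obtain L R where st: "st = (L, R)" by fastforce
  have po: "path_ordered L" using inv by (simp add: st)
  show ?thesis
  proof (cases "fst e \<in> reach L (snd e)")
    case True
    then show ?thesis using inv e fst_mem_reach_iff[OF po, of e] by (simp add: st try_edge.simps Let_def)
  next
    case False
    then have ac: "acyclic (insert e (set L))" using fst_mem_reach_iff[OF po, of e] by simp
    have "weakly_connected (insert e (set L))"
      using inv e by (intro weakly_connected_insert) (auto simp: st)
    moreover have "\<not> acyclic (insert f (insert e (set L)))" if "f \<in> R" for f
      using that inv acyclic_subset[of "insert f (insert e (set L))" "insert f (set L)"]
      by (auto simp: st)
    moreover have "f \<noteq> e" if "f \<in> R" for f using that inv ac by (auto simp: st)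
    moreover have "set (fst (try_edge e st)) = insert e (set L)" "snd (try_edge e st) = R"
      using False by (simp_all add: set_try_edge rejected_try_edge st)
    moreover have "path_ordered (fst (try_edge e st))"
      using path_ordered_try_edge[OF po] by (simp add: st)
    moreover have "distinct (fst (try_edge e st))"
      using False inv e by (auto simp: st try_edge.simps Let_def)
    ultimately show ?thesis
      using inv e by (cases "try_edge e st") (auto simp: st)
  qed
qed

lemma grow_step_cases:
  obtains "filter (eligible A st) es = []" "grow_step es A st = st"
  | e where "e \<in> set es" "eligible A st e" "grow_step es A st = try_edge e st"
proof (cases "filter (eligible A st) es = []")
  case True
  then show thesis using that(1) by (simp add: grow_step_def)
next
  case False
  then have "last (filter (eligible A st) es) \<in> set (filter (eligible A st) es)"
    by (rule last_in_set)
  then show thesis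
    using False by (intro that(2)[of "last (filter (eligible A st) es)"]) (simp_all add: grow_step_def)
qed

lemma grow_inv_step:
  assumes "grow_inv es st"
  shows "grow_inv es (grow_step es A st)"
proof (rule grow_step_cases[of A st es])
  fix e assume e: "e \<in> set es" "eligible A st e" "grow_step es A st = try_edge e st"
  obtain L R where "st = (L, R)" by fastforce
  then show ?thesis using grow_inv_try_edge[OF assms e(1)] e(2,3) by simp
qed (use assms in simp)

lemma grow_inv_grow:
  assumes "grow_inv es st"
  shows "grow_inv es (grow es A st)"
proof -
  have "grow_inv es ((grow_step es A ^^ n) st)" for n
    by (induction n) (simp_all add: assms grow_inv_step del: grow_inv.simps)
  then show ?thesis unfolding grow_def .
qed

lemma grow_induct [consumes 1, case_names step]:
  assumes "P st"
    and "\<And>st e. P st \<Longrightarrow> e \<in> set es \<Longrightarrow> eligible A st e \<Longrightarrow> P (try_edge e st)"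
  shows "P (grow es A st)"
proof -
  have "P ((grow_step es A ^^ n) st)" for n
  proof (induction n)
    case (Suc n)
    show ?case
    proof (rule grow_step_cases[of A "(grow_step es A ^^ n) st" es])
      fix e assume "e \<in> set es" "eligible A ((grow_step es A ^^ n) st) e"
        "grow_step es A ((grow_step es A ^^ n) st) = try_edge e ((grow_step es A ^^ n) st)"
      then show ?thesis using assms(2)[OF Suc] by simp
    qed (use Suc in simp)
  qed (simp add: assms(1))
  then show ?thesis by (simp add: grow_def)
qed

lemma chosen_subset_grow: "set (fst st) \<subseteq> set (fst (grow es A st))"
proof -
  have "set (fst st) \<subseteq> set (fst st)" ..
  then show ?thesis
    by (rule grow_induct[where P = "\<lambda>st'. set (fst st) \<subseteq> set (fst st')"]) (auto simp: set_try_edge)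
qed

text \<open>Every round that does not stop decides another edge, so \<open>length es\<close> rounds decide every edge
  that can be decided.\<close>

lemma not_eligible_grow:
  assumes "grow_inv es st" "e \<in> set es"
  shows "\<not> eligible A (grow es A st) e"
proof -
  define dec where "dec st = (set (fst st) \<union> snd st :: ('a \<times> 'a) set)" for st
  let ?g = "\<lambda>n. (grow_step es A ^^ n) st"
  have inv: "grow_inv es (?g n)" for n
    by (induction n) (simp_all add: assms grow_inv_step del: grow_inv.simps)
  have fin: "finite (dec (?g n)) \<and> dec (?g n) \<subseteq> set es" for n
    using inv[of n] by (cases "?g n") (auto simp: dec_def intro: finite_subset)
  \<comment> \<open>A state without eligible edges is a fixed point, so the first alternative
    persists once it holds.\<close>
  have "filter (eligible A (?g n)) es = [] \<or> n \<le> card (dec (?g n))" for n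
  proof (induction n)
    case (Suc n)
    show ?case
    proof (rule grow_step_cases[of A "?g n" es])
      assume "filter (eligible A (?g n)) es = []" "grow_step es A (?g n) = ?g n"
      then show ?thesis by simp
    next
      fix e assume e: "e \<in> set es" "eligible A (?g n) e"
        "grow_step es A (?g n) = try_edge e (?g n)"
      then have "dec (?g (Suc n)) = insert e (dec (?g n))"
        using decided_try_edge[of e "?g n"] by (simp add: dec_def)
      moreover have "e \<notin> dec (?g n)"
        using e(2) by (cases "?g n") (auto simp: dec_def)
      ultimately have "card (dec (?g (Suc n))) = Suc (card (dec (?g n)))"
        using fin by simp
      moreover have "n \<le> card (dec (?g n))" using Suc e(1,2) by (auto simp: filter_empty_conv)
      ultimately show ?thesis by simp
    qed
  qed simp
  from this[of "length es"] show ?thesis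
  proof
    assume "filter (eligible A (?g (length es))) es = []"
    then show ?thesis using assms(2) by (auto simp: filter_empty_conv grow_def)
  next
    assume "length es \<le> card (dec (?g (length es)))"
    then have "dec (?g (length es)) = set es"
      using fin[of "length es"]
      by (meson List.finite_set card_length card_seteq le_trans)
    then show ?thesis
      using assms(2) by (cases "?g (length es)") (auto simp: dec_def grow_def)
  qed
qed

section \<open>What growing achieves\<close>

lemma grow_maximal:
  assumes "grow_inv es st" "A = set es"
  shows "set (fst (grow es A st)) \<in> maximal_connected_dags (set es)"
proof -
  obtain L R where LR: "grow es A st = (L, R)" by fastforce
  have inv: "grow_inv es (L, R)" using grow_inv_grow[OF assms(1)] LR by metis
  have "\<not> (set L \<subset> F \<and> F \<subseteq> set es \<and> connected_dag F)" for F
  proof (intro notI, elim conjE)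
    assume F: "set L \<subset> F" "F \<subseteq> set es" "connected_dag F"
    obtain f where f: "f \<in> F - set L" "L = [] \<or> fst f \<in> Field (set L) \<or> snd f \<in> Field (set L)"
      using weakly_connected_attached_edge[of F "set L"] F
      by (metis DiffI connected_dag_def psubset_imp_ex_mem set_empty)
    have "f \<in> R"
      \<comment> \<open>The attached edge \<open>f\<close> is neither chosen nor eligible, which
        leaves only that it was rejected.\<close>
      using not_eligible_grow[OF assms(1), of f A] f F(2) LR unfolding assms(2) by auto
    then have "\<not> acyclic (insert f (set L))" using inv by simp
    moreover have "insert f (set L) \<subseteq> F" using f F by auto
    ultimately show False using F(3) acyclic_subset unfolding connected_dag_def by blast
  qed
  then show ?thesis
    using inv path_ordered_acyclic by (auto simp: LR maximal_connected_dags_def connected_dag_def)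
qed

text \<open>Growing inside an acyclic set never rejects an edge, so it reaches everything connected to the
  starting edge.\<close>

lemma grow_connected_subset:
  assumes e: "e \<in> set es" and ac: "acyclic (insert e A)" and P: "P \<subseteq> A" "P \<subseteq> set es"
    and wc: "weakly_connected (insert e P)"
  shows "insert e P \<subseteq> set (fst (grow es A (try_edge e ([], {}))))"
proof -
  have "e \<notin> Id" using ac acyclic_no_loop[of "insert e A" "fst e"] by (cases e) auto
  \<comment> \<open>\<open>A\<close> need not contain \<open>e\<close>, so \<open>e\<close> is put
    in separately; not being a loop, it is accepted.\<close>
  then have c: "try_edge e ([], {}) = ([e], {})" by (cases e) (auto simp: reach_def try_edge.simps)
  have "grow_inv es ([], {})" by simp
  then have inv: "grow_inv es ([e], {})"
    using grow_inv_try_edge[of es "([], {})" e] e c by simp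
  have "grow_inv es ([e], {}) \<and> e \<in> set (fst ([e], {})) \<and> set (fst ([e], {})) \<subseteq> insert e A \<and>
    snd ([e], {}) = {}"
    using inv by simp
  then have "grow_inv es (grow es A ([e], {})) \<and> e \<in> set (fst (grow es A ([e], {}))) \<and>
    set (fst (grow es A ([e], {}))) \<subseteq> insert e A \<and> snd (grow es A ([e], {})) = {}"
  proof (induction rule: grow_induct[where P =
        "\<lambda>st. grow_inv es st \<and> e \<in> set (fst st) \<and> set (fst st) \<subseteq> insert e A \<and> snd st = {}"])
    case (step st f)
    obtain L R where st: "st = (L, R)" by fastforce
    have f: "f \<in> A" using step by (simp add: st)
    have po: "path_ordered L" using step by (simp add: st)
    have "insert f (set L) \<subseteq> insert e A" using step f by (auto simp: st)
    then have "acyclic (insert f (set L))" using ac acyclic_subset by blast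
    then have "fst f \<notin> reach L (snd f)" using fst_mem_reach_iff[OF po] by blast
    moreover have "grow_inv es (try_edge f st)"
      using step by (intro grow_inv_try_edge) (auto simp: st)
    ultimately show ?case
      using step f by (simp add: set_try_edge rejected_try_edge st)
  qed
  moreover obtain L R where LR: "grow es A ([e], {}) = (L, R)" by fastforce
  ultimately have L: "e \<in> set L" "set L \<subseteq> insert e A" "R = {}"
    by auto
  have "insert e P \<subseteq> set L"
  proof (rule ccontr)
    assume nsub: "\<not> insert e P \<subseteq> set L"
    let ?Q = "insert e P"
    \<comment> \<open>\<open>e\<close> keeps the intersection nonempty, so some missing edge of
      \<open>?Q\<close> is attached to it. As nothing has been rejected, that edge would still be
      eligible.\<close>
    have "e \<in> set L \<inter> ?Q" using L by simp
    then obtain f where f: "f \<in> ?Q - set L \<inter> ?Q" 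
      "fst f \<in> Field (set L \<inter> ?Q) \<or> snd f \<in> Field (set L \<inter> ?Q)"
      using weakly_connected_attached_edge[OF wc, of "set L \<inter> ?Q"] nsub by blast
    have "Field (set L \<inter> ?Q) \<subseteq> Field (set L)" by (auto simp: Field_def)
    then have "eligible A (L, R) f" using f P L by auto
    then show False using not_eligible_grow[OF inv, of f A] f P L(1) LR by auto
  qed
  then show ?thesis by (simp add: c LR)
qed

section \<open>The neighbors of a solution\<close>

definition pruned :: "bool \<Rightarrow> 'v \<times> 'v \<Rightarrow> ('v \<times> 'v) set \<Rightarrow> ('v \<times> 'v) set" where
  "pruned b e S = {f \<in> S. if b then snd f \<noteq> fst e else fst f \<noteq> snd e}"

definition candidate :: "('v \<times> 'v) list \<Rightarrow> bool \<Rightarrow> 'v \<times> 'v \<Rightarrow> ('v \<times> 'v) set \<Rightarrow> ('v \<times> 'v) set" where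
  "candidate es b e S =
    set (fst (grow es (set es) (grow es (pruned b e S) (try_edge e ([], {})))))"

definition neighbors :: "('v \<times> 'v) list \<Rightarrow> ('v \<times> 'v) set \<Rightarrow> ('v \<times> 'v) set set" where
  "neighbors es S = {candidate es b e S | b e. e \<in> set es}"

definition initial_solution :: "('v \<times> 'v) list \<Rightarrow> ('v \<times> 'v) set" where
  "initial_solution es = set (fst (grow es (set es) ([], {})))"

lemma initial_solution_maximal: "initial_solution es \<in> maximal_connected_dags (set es)"
  unfolding initial_solution_def by (rule grow_maximal) auto

lemma candidate_maximal:
  "e \<in> set es \<Longrightarrow> candidate es b e S \<in> maximal_connected_dags (set es)"
  unfolding candidate_def
  by (intro grow_maximal grow_inv_grow grow_inv_try_edge) auto

lemma neighbors_maximal: "neighbors es S \<subseteq> maximal_connected_dags (set es)"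
  by (auto simp: neighbors_def candidate_maximal)

text \<open>A path from the head of \<open>e\<close> back to its tail has a first edge leaving the
  head and a last edge entering the tail; pruning has removed one of these kinds entirely.\<close>

lemma acyclic_insert_pruned:
  assumes "acyclic S" "fst e \<noteq> snd e"
  shows "acyclic (insert e (pruned b e S))"
proof -
  have "acyclic (pruned b e S)"
    using assms(1) by (auto simp: pruned_def intro: acyclic_subset)
  moreover have "(snd e, fst e) \<notin> (pruned b e S)\<^sup>*"
  proof
    assume *: "(snd e, fst e) \<in> (pruned b e S)\<^sup>*"
    show False
    proof (cases b)
      case True
      from * assms(2) True show False by cases (auto simp: pruned_def)
    next
      case False
      from * assms(2) False show False by (cases rule: converse_rtranclE) (auto simp: pruned_def)
    qed
  qed
  ultimately show ?thesis using acyclic_insert[of "fst e" "snd e"] by simp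
qed

section \<open>Proximity and closer neighbors\<close>

definition canonical_order :: "('v \<times> 'v) set \<Rightarrow> ('v \<times> 'v) list" where
  "canonical_order F = (SOME L. set L = F \<and> distinct L \<and> connected_order L)"

text \<open>The order behind it is chosen, not computed: proximity serves the completeness argument
  alone and is never evaluated by a program.\<close>

definition proximity :: "('v \<times> 'v) set \<Rightarrow> ('v \<times> 'v) set \<Rightarrow> ('v \<times> 'v) set" where
  "proximity S F = set (takeWhile (\<lambda>e. e \<in> S) (canonical_order F))"

lemma maximal_connected_dags_finite:
  "F \<in> maximal_connected_dags (set es) \<Longrightarrow> finite F"
  by (auto simp: maximal_connected_dags_def intro: finite_subset)

lemma canonical_order:
  assumes "F \<in> maximal_connected_dags (set es)"
  shows "set (canonical_order F) = F" "distinct (canonical_order F)"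
    "connected_order (canonical_order F)"
proof -
  have "\<exists>L. set L = F \<and> distinct L \<and> connected_order L"
    using assms maximal_connected_dags_finite
    by (intro connected_order_exists) (auto simp: maximal_connected_dags_def)
  from someI_ex[OF this] show "set (canonical_order F) = F" "distinct (canonical_order F)"
    "connected_order (canonical_order F)" by (auto simp: canonical_order_def)
qed

lemma proximity_subset:
  assumes "F \<in> maximal_connected_dags (set es)"
  shows "proximity S F \<subseteq> F"
  using canonical_order(1)[OF assms] set_takeWhileD by (fastforce simp: proximity_def)

lemma exists_closer_neighbor:
  assumes S: "S \<in> maximal_connected_dags (set es)" and F: "F \<in> maximal_connected_dags (set es)"
    and "S \<noteq> F"
  shows "\<exists>S' \<in> neighbors es S. card (proximity S F) < card (proximity S' F)"
proof -
  define L where "L = canonical_order F"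
  have L: "set L = F" "distinct L" "connected_order L"
    using canonical_order[OF F] by (auto simp: L_def)
  define k where "k = length (takeWhile (\<lambda>e. e \<in> S) L)"
  have tk: "takeWhile (\<lambda>e. e \<in> S) L = take k L"
    unfolding k_def by (rule takeWhile_eq_take)
  \<comment> \<open>Both are maximal, so inclusion would force equality.\<close>
  have "\<not> F \<subseteq> S"
    using S F \<open>S \<noteq> F\<close> by (auto simp: maximal_connected_dags_def)
  have k: "k < length L"
  proof (rule ccontr)
    assume "\<not> k < length L"
    then have "takeWhile (\<lambda>e. e \<in> S) L = L" by (simp add: tk)
    then show False using \<open>\<not> F \<subseteq> S\<close> L(1) by (auto simp: takeWhile_eq_all_conv)
  qed
  define e where "e = L ! k"
  have "e \<in> F" using k L(1) by (auto simp: e_def)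
  then have e: "e \<in> set es" "fst e \<noteq> snd e"
    using F acyclic_no_loop[of F "fst e"]
    by (auto simp: maximal_connected_dags_def connected_dag_def) (metis prod.collapse)
  define P where "P = set (take k L)"
  have PS: "P \<subseteq> S" using set_takeWhileD[of _ "\<lambda>e. e \<in> S" L] by (auto simp: P_def tk[symmetric])
  have prefix: "set (take (Suc k) L) = insert e P"
    using k by (simp add: take_Suc_conv_app_nth P_def e_def)
  note * = L(3)[unfolded connected_order_def, rule_format, OF k, folded e_def, unfolded prefix]
  have wc: "weakly_connected (insert e P)" and per: "peripheral (insert e P) e"
    using * by simp_all
  \<comment> \<open>The witness for \<open>b\<close>: if no edge of the extended prefix enters the
    tail of \<open>e\<close>, the edges entering it are pruned; otherwise \<open>peripheral\<close>
    says that none leaves the head, and the edges leaving it are pruned.\<close>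
  have "P \<subseteq> pruned (fst e \<notin> Range (insert e P)) e S"
  proof
    fix f assume "f \<in> P"
    then have "f \<in> S" "fst f \<in> Domain (insert e P)" "snd f \<in> Range (insert e P)"
      using PS by (cases f, force)+
    then show "f \<in> pruned (fst e \<notin> Range (insert e P)) e S"
      using per unfolding peripheral_def pruned_def by auto
  qed
  then obtain b where b: "P \<subseteq> pruned b e S" by blast
  have "acyclic S" "S \<subseteq> set es" using S by (auto simp: maximal_connected_dags_def connected_dag_def)
  then have "insert e P \<subseteq> set (fst (grow es (pruned b e S) (try_edge e ([], {}))))"
    using e b wc PS acyclic_insert_pruned[of S e b] by (intro grow_connected_subset) auto
  then have "insert e P \<subseteq> candidate es b e S"
    unfolding candidate_def using chosen_subset_grow by blast
  moreover have "candidate es b e S \<in> neighbors es S"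
    using e(1) unfolding neighbors_def by blast
  moreover have "card (proximity S F) < card (proximity S' F)" if "insert e P \<subseteq> S'" for S'
  proof -
    have "takeWhile (\<lambda>e. e \<in> S') L = take (Suc k) L @ takeWhile (\<lambda>e. e \<in> S') (drop (Suc k) L)"
      using takeWhile_append2[of "take (Suc k) L" "\<lambda>e. e \<in> S'" "drop (Suc k) L"]
        subsetD[OF that[folded prefix]] by (simp only: append_take_drop_id)
    then have "Suc k \<le> length (takeWhile (\<lambda>e. e \<in> S') L)" using k by simp
    moreover have "card (proximity X F) = length (takeWhile (\<lambda>e. e \<in> X) L)" for X
      unfolding proximity_def L_def[symmetric] using L(2) by (simp add: distinct_card)
    ultimately show ?thesis by (simp add: k_def[symmetric])
  qed
  ultimately show ?thesis by blast
qed

text \<open>As long as \<open>F\<close> is not reached, some neighbor is closer to it, and the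
  proximity never exceeds \<open>card F\<close>. So from any member of \<open>X\<close> a chain of
  neighbors ends in \<open>F\<close>.\<close>

lemma neighbors_closed_complete:
  assumes "X \<subseteq> maximal_connected_dags (set es)" "X \<noteq> {}"
    and "\<And>S. S \<in> X \<Longrightarrow> neighbors es S \<subseteq> X"
  shows "X = maximal_connected_dags (set es)"
proof
  show "maximal_connected_dags (set es) \<subseteq> X"
  proof
    fix F assume F: "F \<in> maximal_connected_dags (set es)"
    have bound: "card (proximity S F) \<le> card F" for S
      using F by (intro card_mono proximity_subset maximal_connected_dags_finite)
    have "F \<in> X" if "S \<in> X" for S
      using that
    proof (induction "card F - card (proximity S F)" arbitrary: S rule: less_induct)
      case less
      show ?case
      proof (cases "S = F")
        case False
        then obtain S' where "S' \<in> neighbors es S" "card (proximity S F) < card (proximity S' F)"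
          using exists_closer_neighbor[of S es F] less.prems assms(1) F by blast
        then show ?thesis
          using bound[of S'] assms(3) less.prems by (intro less.hyps[of S']) auto
      qed (use less in simp)
    qed
    then show "F \<in> X" using assms(2) by blast
  qed
qed (use assms in simp)

section \<open>Counting loops\<close>

text \<open>\<open>Loop i c\<close> runs \<open>c\<close> with register \<open>i\<close> counting from 0 up to the contents of register 0, which
  holds the number of edges and is never written. These programs terminate, so they denote
  functions on states, and their running time is bounded by a polynomial read off the syntax.\<close>

datatype cmd =
    Basic instr
  | Comp cmd cmd  (infixr ";;" 60)
  | Cond test cmd cmd
  | Loop reg cmd

fun compile :: "cmd \<Rightarrow> prog" where
  "compile (Basic i) = Do i"
| "compile (c ;; d) = Seq (compile c) (compile d)"
| "compile (Cond b c d) = If b (compile c) (compile d)"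
| "compile (Loop i c) =
     Seq (Do (Const i 0)) (While (Less i 0) (Seq (compile c) (Do (Inc i))))"

primrec run :: "cmd \<Rightarrow> state \<Rightarrow> state" where
  "run (Basic i) = effect i"
| "run (c ;; d) = (\<lambda>s. run d (run c s))"
| "run (Cond b c d) = (\<lambda>s. if holds b s then run c s else run d s)"
| "run (Loop i c) =
     (\<lambda>s. ((\<lambda>t. effect (Inc i) (run c t)) ^^ regs s 0) (effect (Const i 0) s))"

text \<open>Ticks are dropped here; time is accounted for separately, by
  \<open>cost\<close>.\<close>

primrec events :: "cmd \<Rightarrow> state \<Rightarrow> event list" where
  "events (Basic i) = (\<lambda>s. filter (\<lambda>e. e \<noteq> Tick) [event_of i s])"
| "events (c ;; d) = (\<lambda>s. events c s @ events d (run c s))"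
| "events (Cond b c d) = (\<lambda>s. if holds b s then events c s else events d s)"
| "events (Loop i c) = (\<lambda>s. concat (map
     (\<lambda>j. events c (((\<lambda>t. effect (Inc i) (run c t)) ^^ j) (effect (Const i 0) s))) [0..<regs s 0]))"

fun written_reg :: "instr \<Rightarrow> reg set" where
  "written_reg (Const x n) = {x}"
| "written_reg (Move x y) = {x}"
| "written_reg (Inc x) = {x}"
| "written_reg (Dec x) = {x}"
| "written_reg (Load x a y) = {x}"
| "written_reg _ = {}"

fun written_arr :: "instr \<Rightarrow> arr set" where
  "written_arr (Store a x y) = {a}"
| "written_arr _ = {}"

primrec written_regs :: "cmd \<Rightarrow> reg set" where
  "written_regs (Basic i) = written_reg i"
| "written_regs (c ;; d) = written_regs c \<union> written_regs d"
| "written_regs (Cond b c d) = written_regs c \<union> written_regs d"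
| "written_regs (Loop i c) = insert i (written_regs c)"

primrec written_arrs :: "cmd \<Rightarrow> arr set" where
  "written_arrs (Basic i) = written_arr i"
| "written_arrs (c ;; d) = written_arrs c \<union> written_arrs d"
| "written_arrs (Cond b c d) = written_arrs c \<union> written_arrs d"
| "written_arrs (Loop i c) = written_arrs c"

primrec admissible :: "cmd \<Rightarrow> bool" where
  "admissible (Basic i) \<longleftrightarrow> 0 \<notin> written_reg i"
| "admissible (c ;; d) \<longleftrightarrow> admissible c \<and> admissible d"
| "admissible (Cond b c d) \<longleftrightarrow> admissible c \<and> admissible d"
| "admissible (Loop i c) \<longleftrightarrow> i \<noteq> 0 \<and> i \<notin> written_regs c \<and> admissible c"

fun silent_instr :: "instr \<Rightarrow> bool" where
  "silent_instr (Put x) = False"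
| "silent_instr EndSol = False"
| "silent_instr _ = True"

primrec silent :: "cmd \<Rightarrow> bool" where
  "silent (Basic i) \<longleftrightarrow> silent_instr i"
| "silent (c ;; d) \<longleftrightarrow> silent c \<and> silent d"
| "silent (Cond b c d) \<longleftrightarrow> silent c \<and> silent d"
| "silent (Loop i c) \<longleftrightarrow> silent c"

text \<open>An upper bound rather than the exact time: both branches of a conditional are added, so
  that the value depends only on the syntax and on \<open>m\<close>.\<close>

primrec cost :: "nat \<Rightarrow> cmd \<Rightarrow> nat" where
  "cost m (Basic i) = 1"
| "cost m (c ;; d) = cost m c + cost m d"
| "cost m (Cond b c d) = Suc (cost m c + cost m d)"
| "cost m (Loop i c) = 2 + m * (cost m c + 2)"

primrec depth :: "cmd \<Rightarrow> nat" where
  "depth (Basic i) = 0"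
| "depth (c ;; d) = max (depth c) (depth d)"
| "depth (Cond b c d) = max (depth c) (depth d)"
| "depth (Loop i c) = Suc (depth c)"

section \<open>Frame conditions, loop invariants and running time\<close>

definition unchanged :: "cmd \<Rightarrow> state \<Rightarrow> state \<Rightarrow> bool" where
  "unchanged c s t \<longleftrightarrow>
    (\<forall>r. r \<notin> written_regs c \<longrightarrow> regs t r = regs s r) \<and>
    (\<forall>a. a \<notin> written_arrs c \<longrightarrow> arrs t a = arrs s a)"

lemma unchanged_reg: "unchanged c s t \<Longrightarrow> r \<notin> written_regs c \<Longrightarrow> regs t r = regs s r"
  and unchanged_arr: "unchanged c s t \<Longrightarrow> a \<notin> written_arrs c \<Longrightarrow> arrs t a = arrs s a"
  by (simp_all add: unchanged_def)

lemma effect_reg: "r \<notin> written_reg i \<Longrightarrow> regs (effect i s) r = regs s r"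
  and effect_arr: "a \<notin> written_arr i \<Longrightarrow> arrs (effect i s) a = arrs s a"
  by (cases i; simp)+

lemma unchanged_run: "unchanged c s (run c s)"
proof (induction c arbitrary: s)
  case (Loop i c)
  have "unchanged (Loop i c) s (((\<lambda>t. effect (Inc i) (run c t)) ^^ n) (effect (Const i 0) s))" for n
    by (induction n) (use Loop in \<open>auto simp: unchanged_def\<close>)
  then show ?case by simp
qed (auto simp: unchanged_def effect_reg effect_arr)

lemmas run_reg = unchanged_reg[OF unchanged_run]
  and run_arr = unchanged_arr[OF unchanged_run]

lemma admissible_reg_0: "admissible c \<Longrightarrow> 0 \<notin> written_regs c"
  by (induction c) auto

lemma silent_events: "silent c \<Longrightarrow> events c s = []"
proof (induction c arbitrary: s)
  case (Basic i)
  then show ?case by (cases i) auto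
qed auto

text \<open>Each round is handed the value of the counter and the frame of the whole loop, so an
  invariant has to mention only what the body changes.\<close>

lemma Loop_invariant_events:
  assumes "admissible (Loop i c)"
    and "I 0 [] (effect (Const i 0) s)"
    and "\<And>j es t. j < regs s 0 \<Longrightarrow> I j es t \<Longrightarrow> regs t i = j \<Longrightarrow> unchanged (Loop i c) s t \<Longrightarrow>
      I (Suc j) (es @ events c t) (effect (Inc i) (run c t))"
  shows "I (regs s 0) (events (Loop i c) s) (run (Loop i c) s)"
proof -
  let ?f = "\<lambda>j. ((\<lambda>t. effect (Inc i) (run c t)) ^^ j) (effect (Const i 0) s)"
  let ?e = "\<lambda>j. concat (map (\<lambda>j. events c (?f j)) [0..<j])"
  have "j \<le> regs s 0 \<Longrightarrow> I j (?e j) (?f j) \<and> regs (?f j) i = j \<and> unchanged (Loop i c) s (?f j)" for j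
  proof (induction j)
    case (Suc j)
    then have *: "I j (?e j) (?f j)" "regs (?f j) i = j" "unchanged (Loop i c) s (?f j)" by auto
    have "regs (run c (?f j)) i = j"
      using *(2) assms(1) by (simp add: run_reg)
    moreover have "unchanged (Loop i c) s (?f (Suc j))"
      using *(3) unchanged_run[of c "?f j"] by (auto simp: unchanged_def)
    ultimately show ?case using assms(3)[OF _ *] Suc.prems by simp
  qed (use assms(2) in \<open>auto simp: unchanged_def\<close>)
  then show ?thesis by simp
qed

lemma Loop_invariant:
  assumes "admissible (Loop i c)"
    and "I 0 (effect (Const i 0) s)"
    and "\<And>j t. j < regs s 0 \<Longrightarrow> I j t \<Longrightarrow> regs t i = j \<Longrightarrow> unchanged (Loop i c) s t \<Longrightarrow>
      I (Suc j) (effect (Inc i) (run c t))"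
  shows "I (regs s 0) (run (Loop i c) s)"
  using Loop_invariant_events[of i c "\<lambda>j _. I j" s] assms by blast

text \<open>The induction is on the number \<open>n\<close> of remaining rounds, with the counter
  starting anywhere. In the time bound, 2 per round pays for the test and the increment, and
  \<open>Suc\<close> for the final test that fails.\<close>

lemma exec_counting_while:
  fixes i c
  defines "f \<equiv> \<lambda>t. effect (Inc i) (run c t)"
    and "loop \<equiv> While (Less i 0) (Seq (compile c) (Do (Inc i)))"
  assumes body: "\<And>t. regs t 0 = m \<Longrightarrow> \<exists>tr. exec (compile c) t tr (run c t) \<and>
      filter (\<lambda>e. e \<noteq> Tick) tr = events c t \<and> length tr \<le> k"
    and adm: "admissible (Loop i c)"
    and "regs t 0 = m" "regs t i + n = m"
  shows "\<exists>tr. exec loop t tr ((f ^^ n) t) \<and>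
      filter (\<lambda>e. e \<noteq> Tick) tr = concat (map (\<lambda>j. events c ((f ^^ j) t)) [0..<n]) \<and>
      length tr \<le> Suc (n * (k + 2))"
  using assms(5,6)
proof (induction n arbitrary: t)
  case 0
  then have "exec loop t [Tick] t"
    unfolding loop_def by (intro exec.WhileFalse) simp
  then show ?case by (intro exI[of _ "[Tick]"]) simp
next
  case (Suc n)
  obtain tr where tr: "exec (compile c) t tr (run c t)"
    "filter (\<lambda>e. e \<noteq> Tick) tr = events c t" "length tr \<le> k"
    using body Suc.prems by blast
  have "0 \<notin> written_regs c" "i \<notin> written_regs c" "i \<noteq> 0" using adm admissible_reg_0[of c] by auto
  then have "regs (f t) 0 = m" "regs (f t) i + n = m"
    using Suc.prems by (simp_all add: f_def run_reg)
  from Suc.IH[OF this] obtain tr' where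
    tr': "exec loop (f t) tr' ((f ^^ n) (f t))"
      "filter (\<lambda>e. e \<noteq> Tick) tr' = concat (map (\<lambda>j. events c ((f ^^ j) (f t))) [0..<n])"
      "length tr' \<le> Suc (n * (k + 2))" by blast
  have "exec (Seq (compile c) (Do (Inc i))) t (tr @ [event_of (Inc i) (run c t)]) (f t)"
    unfolding f_def by (rule exec.Seq[OF tr(1) exec.Do])
  then have "exec loop t (Tick # (tr @ [event_of (Inc i) (run c t)]) @ tr') ((f ^^ n) (f t))"
    using Suc.prems tr'(1) unfolding loop_def by (intro exec.WhileTrue) simp_all
  moreover have "(f ^^ n) (f t) = (f ^^ Suc n) t" by (simp add: funpow_swap1)
  moreover have "concat (map (\<lambda>j. events c ((f ^^ j) t)) [0..<Suc n]) =
      events c t @ concat (map (\<lambda>j. events c ((f ^^ j) (f t))) [0..<n])"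
    by (simp add: upt_conv_Cons map_Suc_upt[symmetric] funpow_swap1 o_def del: upt_Suc)
  ultimately show ?case
    using tr(2,3) tr'(2,3)
    by (intro exI[of _ "Tick # (tr @ [event_of (Inc i) (run c t)]) @ tr'"]) (simp del: funpow.simps upt_Suc)
qed

lemma exec_compile:
  assumes "admissible c" "regs s 0 = m"
  shows "\<exists>tr. exec (compile c) s tr (run c s) \<and> filter (\<lambda>e. e \<noteq> Tick) tr = events c s \<and>
    length tr \<le> cost m c"
  using assms
proof (induction c arbitrary: s)
  case (Basic i)
  then show ?case using exec.Do[of i s] by (intro exI[of _ "[event_of i s]"]) simp
next
  case (Comp c d)
  then obtain tr where tr: "exec (compile c) s tr (run c s)"
    "filter (\<lambda>e. e \<noteq> Tick) tr = events c s" "length tr \<le> cost m c" by auto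
  have "regs (run c s) 0 = m" using Comp.prems by (simp add: run_reg admissible_reg_0)
  then obtain tr' where tr': "exec (compile d) (run c s) tr' (run d (run c s))"
    "filter (\<lambda>e. e \<noteq> Tick) tr' = events d (run c s)" "length tr' \<le> cost m d"
    using Comp by auto
  show ?case
    using exec.Seq[OF tr(1) tr'(1)] tr(2,3) tr'(2,3) by (intro exI[of _ "tr @ tr'"]) simp
next
  case (Cond b c d)
  show ?case
  proof (cases "holds b s")
    case True
    obtain tr where tr: "exec (compile c) s tr (run c s)"
      "filter (\<lambda>e. e \<noteq> Tick) tr = events c s" "length tr \<le> cost m c" using Cond by auto
    show ?thesis
      using exec.IfTrue[OF True tr(1)] tr(2,3) True by (intro exI[of _ "Tick # tr"]) simp
  next
    case False
    obtain tr where tr: "exec (compile d) s tr (run d s)"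
      "filter (\<lambda>e. e \<noteq> Tick) tr = events d s" "length tr \<le> cost m d" using Cond by auto
    show ?thesis
      using exec.IfFalse[OF False tr(1)] tr(2,3) False by (intro exI[of _ "Tick # tr"]) simp
  qed
next
  case (Loop i c)
  have "i \<noteq> 0" using Loop.prems by simp
  have body: "\<exists>tr. exec (compile c) t tr (run c t) \<and> filter (\<lambda>e. e \<noteq> Tick) tr = events c t \<and>
      length tr \<le> cost m c" if "regs t 0 = m" for t
    using Loop that by simp
  let ?s = "effect (Const i 0) s"
  have "regs ?s 0 = m" "regs ?s i + m = m" using Loop.prems \<open>i \<noteq> 0\<close> by simp_all
  from exec_counting_while[OF body Loop.prems(1) this] obtain tr where
    tr: "exec (While (Less i 0) (Seq (compile c) (Do (Inc i)))) ?s tr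
        (((\<lambda>t. effect (Inc i) (run c t)) ^^ m) ?s)"
      "filter (\<lambda>e. e \<noteq> Tick) tr =
        concat (map (\<lambda>j. events c (((\<lambda>t. effect (Inc i) (run c t)) ^^ j) ?s)) [0..<m])"
      "length tr \<le> Suc (m * (cost m c + 2))" by blast
  show ?case
    using exec.Seq[OF exec.Do tr(1)] tr(2,3) Loop.prems(2)
    by (intro exI[of _ "[event_of (Const i 0) s] @ tr"]) simp
qed

lemma mono_power_le:
  assumes "\<And>m. f m \<le> (K :: nat) * Suc m ^ k" "k \<le> l"
  shows "f m \<le> K * Suc m ^ l"
  using order.trans[OF assms(1) mult_le_mono2[OF power_increasing[OF assms(2)]]] by simp

text \<open>\<open>Suc m\<close> is the base instead of \<open>m\<close> because a program costs
  something even for \<open>m = 0\<close>.\<close>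

lemma cost_le: "\<exists>K. \<forall>m. cost m c \<le> K * Suc m ^ depth c"
proof (induction c)
  case (Basic i)
  then show ?case by (intro exI[of _ 1]) simp
next
  case (Comp c d)
  then obtain K K' where K: "\<And>m. cost m c \<le> K * Suc m ^ depth c" "\<And>m. cost m d \<le> K' * Suc m ^ depth d"
    by blast
  have "cost m (c ;; d) \<le> (K + K') * Suc m ^ depth (c ;; d)" for m
    unfolding distrib_right cost.simps
    by (intro add_mono mono_power_le[OF K(1)] mono_power_le[OF K(2)]) simp_all
  then show ?case by blast
next
  case (Cond b c d)
  then obtain K K' where K: "\<And>m. cost m c \<le> K * Suc m ^ depth c" "\<And>m. cost m d \<le> K' * Suc m ^ depth d"
    by blast
  have "cost m (Cond b c d) \<le> (K + K' + 1) * Suc m ^ depth (Cond b c d)" for m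
  proof -
    let ?X = "Suc m ^ depth (Cond b c d)"
    have "1 \<le> ?X" by simp
    moreover have "cost m c + cost m d \<le> K * ?X + K' * ?X"
      by (intro add_mono mono_power_le[OF K(1)] mono_power_le[OF K(2)]) simp_all
    ultimately show ?thesis unfolding distrib_right cost.simps by linarith
  qed
  then show ?case by blast
next
  case (Loop i c)
  then obtain K where K: "\<And>m. cost m c \<le> K * Suc m ^ depth c" by blast
  have "2 + m * (cost m c + 2) \<le> (K + 4) * Suc m ^ Suc (depth c)" for m
  proof -
    have "1 \<le> Suc m ^ depth c" by simp
    then have "cost m c + 2 \<le> (K + 2) * Suc m ^ depth c"
      using K[of m] unfolding distrib_right by linarith
    then have "m * (cost m c + 2) \<le> Suc m * ((K + 2) * Suc m ^ depth c)"
      by (intro mult_le_mono) auto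
    also have "\<dots> = (K + 2) * Suc m ^ Suc (depth c)" unfolding power_Suc by (rule mult.left_commute)
    finally show ?thesis
      using one_le_power[of "Suc m" "Suc (depth c)"] unfolding distrib_right by linarith
  qed
  then show ?case by auto
qed

lemma power_Suc_bigo: "(\<lambda>n. real (K * Suc n ^ d)) \<in> O(\<lambda>n. real n ^ d)"
proof (rule bigoI)
  have "real (K * Suc n ^ d) \<le> real K * 2 ^ d * real n ^ d" if "n \<ge> 1" for n
  proof -
    have "real (Suc n) ^ d \<le> (2 * real n) ^ d"
      using that by (intro power_mono) auto
    then show ?thesis by (simp add: power_mult_distrib mult_left_mono mult.assoc)
  qed
  then show "\<forall>\<^sub>F n in at_top. norm (real (K * Suc n ^ d)) \<le> real K * 2 ^ d * norm (real n ^ d)"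
    by (auto simp: eventually_at_top_linorder intro!: exI[of _ 1])
qed

section \<open>Growing on the machine\<close>

abbreviation (input) "r_given \<equiv> 2 :: reg"
abbreviation (input) "r_count \<equiv> 3 :: reg"
abbreviation (input) "r_edge \<equiv> 4 :: reg"
abbreviation (input) "r_tail \<equiv> 5 :: reg"
abbreviation (input) "r_head \<equiv> 6 :: reg"
abbreviation (input) "r_j \<equiv> 7 :: reg"
abbreviation (input) "r_x \<equiv> 8 :: reg"
abbreviation (input) "r_y \<equiv> 9 :: reg"
abbreviation (input) "r_pos \<equiv> 11 :: reg"
abbreviation (input) "r_num \<equiv> 12 :: reg"
abbreviation (input) "r_one \<equiv> 13 :: reg"
abbreviation (input) "r_zero \<equiv> 14 :: reg"
abbreviation (input) "r_round \<equiv> 15 :: reg"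
abbreviation (input) "r_found \<equiv> 16 :: reg"
abbreviation (input) "r_pivot \<equiv> 17 :: reg"

abbreviation (input) "a_tails \<equiv> 0 :: arr"
abbreviation (input) "a_heads \<equiv> 1 :: arr"
abbreviation (input) "a_given \<equiv> 2 :: arr"
abbreviation (input) "a_chosen \<equiv> 3 :: arr"
abbreviation (input) "a_order \<equiv> 4 :: arr"
abbreviation (input) "a_spare \<equiv> 5 :: arr"
abbreviation (input) "a_touched \<equiv> 6 :: arr"
abbreviation (input) "a_marked \<equiv> 7 :: arr"
abbreviation (input) "a_allowed \<equiv> 8 :: arr"
abbreviation (input) "a_current \<equiv> 9 :: arr"
abbreviation (input) "a_decided \<equiv> 13 :: arr"

declare run.simps(4) [simp del] events.simps(4) [simp del]

declare [[coercion Basic]]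

text \<open>A self-move plays the role of an empty instruction.\<close>

abbreviation cmd_when :: "test \<Rightarrow> cmd \<Rightarrow> cmd" where
  "cmd_when b c \<equiv> Cond b c (Move r_x r_x)"

lemma effect_Move_self [simp]: "effect (Move x x) s = s"
  by simp

section \<open>Edge sets, vertex sets and edge lists in memory\<close>

definition graph :: "(nat \<times> nat) list \<Rightarrow> state \<Rightarrow> bool" where
  "graph es s \<longleftrightarrow> regs s 0 = length es \<and> regs s r_one = 1 \<and> regs s r_zero = 0 \<and>
    (\<forall>j < length es. arrs s a_tails j = fst (es ! j) \<and> arrs s a_heads j = snd (es ! j))"

lemma graph_unchanged:
  assumes "graph es s" "unchanged c s t" "{0, 13, 14} \<inter> written_regs c = {}"
    "{0, 1} \<inter> written_arrs c = {}"
  shows "graph es t"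
  using assms by (auto simp: graph_def unchanged_def)

lemmas graph_run = graph_unchanged[OF _ unchanged_run]

lemma nth_in_Field:
  "j < length es \<Longrightarrow> fst (es ! j) \<in> Field (set es)"
  "j < length es \<Longrightarrow> snd (es ! j) \<in> Field (set es)"
  by (metis FieldI1 FieldI2 nth_mem prod.collapse)+

definition bits :: "'a list \<Rightarrow> (nat \<Rightarrow> nat) \<Rightarrow> 'a set \<Rightarrow> bool" where
  "bits es f S \<longleftrightarrow> (\<forall>j < length es. f j = of_bool (es ! j \<in> S))"

text \<open>Only the endpoints of edges are constrained: these are the cells that a loop over the
  edges can reach and clear.\<close>

definition marks :: "(nat \<times> nat) list \<Rightarrow> (nat \<Rightarrow> nat) \<Rightarrow> nat set \<Rightarrow> bool" where
  "marks es f M \<longleftrightarrow> (\<forall>v \<in> Field (set es). f v = of_bool (v \<in> M))"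

definition listing :: "'a list \<Rightarrow> (nat \<Rightarrow> nat) \<Rightarrow> 'a list \<Rightarrow> bool" where
  "listing es f L \<longleftrightarrow> (\<forall>i < length L. f i < length es \<and> es ! f i = L ! i)"

lemma listing_Nil [simp]: "listing es f []"
  by (simp add: listing_def)

lemma listing_snoc:
  "listing es f L \<Longrightarrow> x < length es \<Longrightarrow> listing es (f(length L := x)) (L @ [es ! x])"
  by (simp add: listing_def nth_append less_Suc_eq)

lemma marks_insert:
  "marks es f M \<Longrightarrow> marks es (f(v := Suc 0)) (insert v M)"
  by (auto simp: marks_def)

definition clear :: "arr \<Rightarrow> cmd" where
  "clear a = Loop r_j (Load r_x a_tails r_j ;; Store a r_x r_zero ;;
     Load r_x a_heads r_j ;; Store a r_x r_zero)"

lemma run_clear: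
  assumes "graph es s" "a \<notin> {0, 1}"
  shows "marks es (arrs (run (clear a) s) a) {}"
proof -
  let ?I = "\<lambda>j t. \<forall>i < j. arrs t a (fst (es ! i)) = 0 \<and> arrs t a (snd (es ! i)) = 0"
  have "?I (regs s 0) (run (clear a) s)"
    unfolding clear_def
  proof (rule Loop_invariant[where I = ?I], goal_cases)
    case (3 j t)
    then have "graph es t" using assms by (intro graph_unchanged[OF _ 3(4)]) auto
    then show ?case
      using 3 assms by (auto simp: graph_def less_Suc_eq)
  qed auto
  then show ?thesis
    using assms by (auto simp: marks_def graph_def Field_def in_set_conv_nth Domain_iff Range_iff)
      (metis fst_conv snd_conv)+
qed

definition fill :: "arr \<Rightarrow> reg \<Rightarrow> cmd" where
  "fill a r = Loop r_j (Store a r_j r)"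

lemma run_fill:
  assumes "regs s 0 = length es" "r \<noteq> r_j" "regs s r = of_bool b"
  shows "bits es (arrs (run (fill a r) s) a) (if b then UNIV else {})"
proof -
  let ?I = "\<lambda>j t. \<forall>i < j. arrs t a i = of_bool b"
  have "?I (regs s 0) (run (fill a r) s)"
    unfolding fill_def
  proof (rule Loop_invariant[where I = ?I], goal_cases)
    case (3 j t)
    have "regs t r = regs s r" using unchanged_reg[OF 3(4), of r] assms by simp
    then show ?case using 3 assms by (auto simp: less_Suc_eq)
  qed auto
  then show ?thesis using assms by (auto simp: bits_def)
qed

text \<open>The list determines the chosen edges and touched vertices, which the arrays repeat so
  that eligibility and membership can be read off in constant time.\<close>

definition represents :: "(nat \<times> nat) list \<Rightarrow> nat search_state \<Rightarrow> state \<Rightarrow> bool" where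
  "represents es st s \<longleftrightarrow> graph es s \<and> distinct (fst st) \<and> set (fst st) \<subseteq> set es \<and>
    regs s r_count = length (fst st) \<and> listing es (arrs s a_order) (fst st) \<and>
    bits es (arrs s a_chosen) (set (fst st)) \<and>
    bits es (arrs s a_decided) (set (fst st) \<union> snd st) \<and>
    marks es (arrs s a_touched) (Field (set (fst st)))"

lemma represents_unchanged:
  assumes "represents es st s" "unchanged c s t" "{0, 3, 13, 14} \<inter> written_regs c = {}"
    "{0, 1, 3, 4, 6, 13} \<inter> written_arrs c = {}"
  shows "represents es st t"
proof -
  have "graph es t"
    using assms by (intro graph_unchanged[OF _ assms(2)]) (auto simp: represents_def)
  then show ?thesis
    using assms by (auto simp: represents_def unchanged_def)
qed

lemmas represents_run = represents_unchanged[OF _ unchanged_run]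

lemma represents_length_le:
  "represents es st s \<Longrightarrow> length (fst st) \<le> length es"
  unfolding represents_def
  by (metis List.finite_set card_length card_mono distinct_card le_trans)

definition reset :: cmd where
  "reset = clear a_touched ;; Const r_count 0 ;; fill a_chosen r_zero ;; fill a_decided r_zero"

lemma run_reset:
  assumes "graph es s"
  shows "represents es ([], {}) (run reset s)"
proof -
  define s1 where "s1 = run (clear a_touched) s"
  define s2 where "s2 = effect (Const r_count 0) s1"
  define s3 where "s3 = run (fill a_chosen r_zero) s2"
  define s4 where "s4 = run (fill a_decided r_zero) s3"
  have g1: "graph es s1" using assms by (simp add: s1_def clear_def graph_run)
  have g2: "graph es s2" using g1 by (simp add: s2_def graph_def)
  have g3: "graph es s3" using g2 by (simp add: s3_def fill_def graph_run)
  have g4: "graph es s4" using g3 by (simp add: s4_def fill_def graph_run)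
  have "marks es (arrs s1 a_touched) {}" using run_clear[OF assms] by (simp add: s1_def)
  moreover have "arrs s4 a_touched = arrs s1 a_touched"
    by (simp add: s4_def s3_def s2_def fill_def run_arr)
  moreover have "bits es (arrs s3 a_chosen) {}"
    using run_fill[of s2 es r_zero False a_chosen] g2 by (simp add: s3_def graph_def)
  moreover have "arrs s4 a_chosen = arrs s3 a_chosen" by (simp add: s4_def fill_def run_arr)
  moreover have "bits es (arrs s4 a_decided) {}"
    using run_fill[of s3 es r_zero False a_decided] g3 by (simp add: s4_def graph_def)
  moreover have "regs s4 r_count = 0"
    by (simp add: s4_def s3_def fill_def run_reg) (simp add: s2_def)
  moreover have "run reset s = s4" by (simp add: reset_def s4_def s3_def s2_def s1_def)
  ultimately show ?thesis using g4 by (simp add: represents_def)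
qed

section \<open>Testing and adding one edge\<close>

definition mark_step :: cmd where
  "mark_step = cmd_when (Less r_j r_count)
     (Load r_y a_order r_j ;; Load r_x a_tails r_y ;; Load r_x a_marked r_x ;;
      cmd_when (Equal r_x r_one) (Load r_x a_heads r_y ;; Store a_marked r_x r_one))"

definition mark_reach :: cmd where
  "mark_reach = clear a_marked ;; Store a_marked r_head r_one ;; Loop r_j mark_step"

lemma run_mark_reach:
  assumes rep: "represents es (L, R) s" and v: "regs s r_head \<in> Field (set es)"
  shows "marks es (arrs (run mark_reach s) a_marked) (reach L (regs s r_head))"
proof -
  let ?v = "regs s r_head"
  define s1 where "s1 = run (clear a_marked) s"
  define s2 where "s2 = effect (Store a_marked r_head r_one) s1"
  have rep1: "represents es (L, R) s1" using rep by (simp add: s1_def clear_def represents_run)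
  have "graph es s" using rep by (simp add: represents_def)
  then have "marks es (arrs s1 a_marked) {}" using run_clear[of es s a_marked] by (simp add: s1_def)
  moreover have "regs s1 r_head = ?v" by (simp add: s1_def clear_def run_reg)
  ultimately have m2: "marks es (arrs s2 a_marked) {?v}"
    using rep1 by (auto simp: s2_def represents_def graph_def intro: marks_insert[of es _ "{}", simplified])
  have rep2: "represents es (L, R) s2" using rep1 by (simp add: s2_def represents_def graph_def)
  let ?I = "\<lambda>j t. marks es (arrs t a_marked) (reach (take j L) ?v)"
  have "?I (regs s2 0) (run (Loop r_j mark_step) s2)"
  proof (rule Loop_invariant[where I = ?I], goal_cases)
    case 1
    show ?case by (simp add: mark_step_def)
  next
    case 2
    show ?case using m2 by (simp add: reach_def)
  next
    case (3 j t)
    have rept: "represents es (L, R) t"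
      using rep2 by (rule represents_unchanged[OF _ 3(4)]) (auto simp: mark_step_def)
    show ?case
    proof (cases "j < length L")
      case False
      then show ?thesis using 3(2,3) rept by (simp add: mark_step_def represents_def)
    next
      case True
      let ?i = "arrs t a_order j"
      have i: "?i < length es" "es ! ?i = L ! j"
        using rept True by (auto simp: represents_def listing_def)
      have t: "regs t r_count = length L" "regs t r_one = 1"
        "arrs t a_tails ?i = fst (L ! j)" "arrs t a_heads ?i = snd (L ! j)"
        using rept i by (auto simp: represents_def graph_def)
      have "arrs t a_marked (fst (L ! j)) = of_bool (fst (L ! j) \<in> reach (take j L) ?v)"
        using 3(2) nth_in_Field(1)[OF i(1)] i(2) by (simp add: marks_def)
      then show ?thesis
        using 3(2,3) True t by (auto simp: mark_step_def take_Suc_conv_app_nth reach_snoc marks_def)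
    qed
  qed
  moreover have "run mark_reach s = run (Loop r_j mark_step) s2"
    by (simp add: mark_reach_def s2_def s1_def)
  \<comment> \<open>One round per edge of the graph covers the whole list; the guard in
    \<open>mark_step\<close> makes the surplus rounds idle.\<close>
  moreover have "length L \<le> regs s2 0"
    using represents_length_le[OF rep2] rep2 by (simp add: represents_def graph_def)
  ultimately show ?thesis by simp
qed

text \<open>A stable partition: edges that stay are written back into the array being read, and only
  those that move go to the spare array, from which they are appended behind the new edge.\<close>

definition split_step :: cmd where
  "split_step = cmd_when (Less r_j r_count)
     (Load r_y a_order r_j ;; Load r_x a_tails r_y ;; Load r_x a_marked r_x ;;
      Cond (Equal r_x r_one)
        (Store a_spare r_num r_y ;; Inc r_num)
        (Store a_order r_pos r_y ;; Inc r_pos))"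

definition append_step :: cmd where
  "append_step = cmd_when (Less r_j r_num)
     (Load r_y a_spare r_j ;; Store a_order r_pos r_y ;; Inc r_pos)"

definition reorder :: cmd where
  "reorder = Const r_pos 0 ;; Const r_num 0 ;; Loop r_j split_step ;;
     Store a_order r_pos r_edge ;; Inc r_pos ;; Loop r_j append_step ;; Move r_count r_pos"

lemma run_reorder:
  assumes g: "graph es s" and L: "regs s r_count = length L" "length L \<le> length es"
    "listing es (arrs s a_order) L" and M: "marks es (arrs s a_marked) M"
    and e: "regs s r_edge < length es"
  shows "listing es (arrs (run reorder s) a_order)
      (filter (\<lambda>f. fst f \<notin> M) L @ es ! regs s r_edge # filter (\<lambda>f. fst f \<in> M) L)" (is ?thesis1)
    and "regs (run reorder s) r_count = Suc (length L)" (is ?thesis2)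
proof -
  define s1 where "s1 = effect (Const r_num 0) (effect (Const r_pos 0) s)"
  define s2 where "s2 = run (Loop r_j split_step) s1"
  define s3 where "s3 = effect (Inc r_pos) (effect (Store a_order r_pos r_edge) s2)"
  define s4 where "s4 = run (Loop r_j append_step) s3"
  have g1: "graph es s1" using g by (simp add: s1_def graph_def)
  have s1: "regs s1 r_count = length L" "arrs s1 = arrs s" "regs s1 r_edge = regs s r_edge"
    "regs s1 r_pos = 0" "regs s1 r_num = 0" "regs s1 0 = length es"
    using L g by (simp_all add: s1_def graph_def)
  let ?U = "\<lambda>j. filter (\<lambda>f. fst f \<notin> M) (take j L)" and ?T = "\<lambda>j. filter (\<lambda>f. fst f \<in> M) (take j L)"
  let ?I = "\<lambda>j t. regs t r_pos = length (?U j) \<and> regs t r_num = length (?T j) \<and>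
     listing es (arrs t a_order) (?U j) \<and> listing es (arrs t a_spare) (?T j) \<and>
     (\<forall>i. j \<le> i \<longrightarrow> arrs t a_order i = arrs s a_order i)"
  have "?I (regs s1 0) s2"
    unfolding s2_def
  proof (rule Loop_invariant[where I = ?I], goal_cases)
    case 1
    show ?case by (simp add: split_step_def)
  next
    case 2
    show ?case using s1 by simp
  next
    case (3 j t)
    have gt: "graph es t" using g1 by (rule graph_unchanged[OF _ 3(4)]) (auto simp: split_step_def)
    have t: "regs t r_count = length L" "arrs t a_marked = arrs s a_marked"
      using s1 unchanged_reg[OF 3(4), of r_count] unchanged_arr[OF 3(4), of a_marked]
      by (simp_all add: split_step_def)
    show ?case
    proof (cases "j < length L")
      case False
      then show ?thesis using 3(2,3) t by (simp add: split_step_def)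
    next
      case True
      let ?i = "arrs t a_order j"
      have i: "?i < length es" "es ! ?i = L ! j"
        using L True 3(2) by (auto simp: listing_def)
      have "arrs t a_marked (fst (L ! j)) = of_bool (fst (L ! j) \<in> M)"
        using M nth_in_Field(1)[OF i(1)] i(2) t by (simp add: marks_def)
      moreover have "arrs t a_tails ?i = fst (L ! j)" "regs t r_one = 1"
        using gt i by (simp_all add: graph_def)
      \<comment> \<open>The writing position never overtakes the reading position, so the cells
        still to be read keep their old contents.\<close>
      moreover have "length (?U j) \<le> j"
        using length_filter_le[of "\<lambda>f. fst f \<notin> M" "take j L"] by simp
      ultimately show ?thesis
        using 3(2,3) True t i listing_snoc[of es "arrs t a_order" "?U j" ?i]
          listing_snoc[of es "arrs t a_spare" "?T j" ?i]
        by (cases "fst (L ! j) \<in> M") (simp_all add: split_step_def take_Suc_conv_app_nth)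
    qed
  qed
  then have s2: "regs s2 r_pos = length (?U (length L))" "regs s2 r_num = length (?T (length L))"
    "listing es (arrs s2 a_order) (?U (length L))" "listing es (arrs s2 a_spare) (?T (length L))"
    using L s1 by simp_all
  have s2': "regs s2 r_edge = regs s r_edge" "regs s2 0 = length es"
    using s1 by (simp_all add: s2_def split_step_def run_reg)
  let ?A = "?U (length L) @ [es ! regs s r_edge]"
  have s3: "regs s3 r_pos = length ?A" "regs s3 r_num = length (?T (length L))"
    "listing es (arrs s3 a_order) ?A" "listing es (arrs s3 a_spare) (?T (length L))" "regs s3 0 = length es"
    using s2 s2' e listing_snoc[OF s2(3), of "regs s r_edge"] by (simp_all add: s3_def)
  let ?J = "\<lambda>j t. regs t r_pos = length (?A @ take j (?T (length L))) \<and>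
    listing es (arrs t a_order) (?A @ take j (?T (length L)))"
  have "?J (regs s3 0) s4"
    unfolding s4_def
  proof (rule Loop_invariant[where I = ?J], goal_cases)
    case 1
    show ?case by (simp add: append_step_def)
  next
    case 2
    show ?case using s3 by simp
  next
    case (3 j t)
    have t: "regs t r_num = length (?T (length L))" "arrs t a_spare = arrs s3 a_spare"
      using s3 unchanged_reg[OF 3(4), of r_num] unchanged_arr[OF 3(4), of a_spare]
      by (simp_all add: append_step_def)
    show ?case
    proof (cases "j < length (?T (length L))")
      case False
      then show ?thesis using 3(2,3) t by (simp add: append_step_def)
    next
      case True
      have "arrs t a_spare j < length es" "es ! arrs t a_spare j = ?T (length L) ! j"
        using s3(4) True t by (simp_all add: listing_def)
      then show ?thesis
        using 3(2,3) True t
          listing_snoc[of es "arrs t a_order" "?A @ take j (?T (length L))" "arrs t a_spare j"]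
        by (simp add: append_step_def take_Suc_conv_app_nth)
    qed
  qed
  moreover have len: "length (?T (length L)) \<le> regs s3 0"
    using order.trans[OF length_filter_le[of "\<lambda>f. fst f \<in> M" L] L(2)] s3 by simp
  moreover have "run reorder s = effect (Move r_count r_pos) s4"
    by (simp add: reorder_def s4_def s3_def s2_def s1_def)
  moreover have "length (?U (length L)) + length (?T (length L)) = length L"
    using sum_length_filter_compl[of "\<lambda>f. fst f \<in> M" L] by simp
  ultimately show ?thesis1 ?thesis2 by simp_all
qed

definition accept :: cmd where
  "accept = Store a_chosen r_edge r_one ;; Store a_decided r_edge r_one ;;
     Store a_touched r_tail r_one ;; Store a_touched r_head r_one ;; reorder"

definition attempt :: cmd where
  "attempt = Load r_tail a_tails r_edge ;; Load r_head a_heads r_edge ;; mark_reach ;;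
     Load r_x a_marked r_tail ;; Cond (Equal r_x r_one) (Store a_decided r_edge r_one) accept"

lemma bits_insert:
  "distinct es \<Longrightarrow> bits es f S \<Longrightarrow> i < length es \<Longrightarrow> bits es (f(i := Suc 0)) (insert (es ! i) S)"
  by (auto simp: bits_def nth_eq_iff_index_eq)

lemmas attempt_defs = attempt_def accept_def reorder_def mark_reach_def clear_def mark_step_def
  split_step_def append_step_def

lemma run_attempt:
  assumes rep: "represents es st s" and es: "distinct es"
    and e: "regs s r_edge < length es" "es ! regs s r_edge \<notin> set (fst st)"
  shows "represents es (try_edge (es ! regs s r_edge) st) (run attempt s)"
proof -
  obtain L R where st: "st = (L, R)" by fastforce
  let ?e = "es ! regs s r_edge"
  define s1 where "s1 = effect (Load r_head a_heads r_edge) (effect (Load r_tail a_tails r_edge) s)"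
  define s2 where "s2 = run mark_reach s1"
  define s3 where "s3 = effect (Load r_x a_marked r_tail) s2"
  have run: "run attempt s = (if regs s3 r_x = 1 then effect (Store a_decided r_edge r_one) s3
      else run accept s3)" if "regs s3 r_one = 1"
    using that by (simp add: attempt_def s3_def s2_def s1_def)
  have g: "graph es s" using rep by (simp add: represents_def)
  have s1: "regs s1 r_tail = fst ?e" "regs s1 r_head = snd ?e" "regs s1 r_edge = regs s r_edge"
    using g e by (auto simp: s1_def graph_def)
  have rep1: "represents es (L, R) s1" using rep by (simp add: s1_def represents_def graph_def st)
  let ?M = "reach L (snd ?e)"
  have m2: "marks es (arrs s2 a_marked) ?M"
    using run_mark_reach[OF rep1] s1 nth_in_Field(2)[OF e(1)] by (simp add: s2_def)
  have s2: "regs s2 r_tail = fst ?e" "regs s2 r_head = snd ?e" "regs s2 r_edge = regs s r_edge"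
    by (simp_all add: s2_def run_reg mark_reach_def mark_step_def clear_def s1)
  have "represents es (L, R) s2"
    using rep1 unfolding s2_def
    by (rule represents_run) (auto simp: mark_reach_def mark_step_def clear_def)
  then have rep3: "represents es (L, R) s3" by (simp add: s3_def represents_def graph_def)
  have s3: "regs s3 r_tail = fst ?e" "regs s3 r_head = snd ?e" "regs s3 r_edge = regs s r_edge"
    "marks es (arrs s3 a_marked) ?M" "regs s3 r_x = of_bool (fst ?e \<in> ?M)" "regs s3 r_one = 1"
    using s2 m2 nth_in_Field(1)[OF e(1)] rep3 by (auto simp: s3_def marks_def represents_def graph_def)
  show ?thesis
  proof (cases "fst ?e \<in> ?M")
    case True
    then have "run attempt s = effect (Store a_decided r_edge r_one) s3" using run s3 by simp
    then show ?thesis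
      using rep3 s3 True bits_insert[OF es, of "arrs s3 a_decided" "set L \<union> R" "regs s r_edge"] e
      by (simp add: st try_edge.simps represents_def graph_def)
  next
    case False
    define s4 where "s4 = effect (Store a_touched r_head r_one) (effect (Store a_touched r_tail r_one)
      (effect (Store a_decided r_edge r_one) (effect (Store a_chosen r_edge r_one) s3)))"
    have run: "run attempt s = run reorder s4"
      using False run s3 by (simp add: accept_def s4_def)
    have s4: "regs s4 = regs s3" "arrs s4 a_order = arrs s3 a_order" "arrs s4 a_marked = arrs s3 a_marked"
      "arrs s4 a_chosen = (arrs s3 a_chosen)(regs s r_edge := 1)"
      "arrs s4 a_decided = (arrs s3 a_decided)(regs s r_edge := 1)"
      "arrs s4 a_touched = (arrs s3 a_touched)(fst ?e := 1, snd ?e := 1)"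
      using s3 by (simp_all add: s4_def)
    have g4: "graph es s4" using rep3 by (simp add: s4_def represents_def graph_def)
    have L: "regs s4 r_count = length L" "length L \<le> length es" "listing es (arrs s4 a_order) L"
      using rep3 represents_length_le[OF rep3] s4 by (auto simp: represents_def)
    have M: "marks es (arrs s4 a_marked) ?M" "regs s4 r_edge < length es"
      using s3 s4 e by simp_all
    note r = run_reorder[OF g4 L M]
    have frame: "arrs (run reorder s4) a = arrs s4 a" if "a \<in> {a_chosen, a_decided, a_touched}" for a
      using that by (intro run_arr) (auto simp: reorder_def split_step_def append_step_def)
    have "graph es (run reorder s4)"
      using g4 by (rule graph_run) (auto simp: reorder_def split_step_def append_step_def)
    moreover have "bits es (arrs s4 a_chosen) (insert ?e (set L))"
      "bits es (arrs s4 a_decided) (insert ?e (set L \<union> R))"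
      "marks es (arrs s4 a_touched) (Field (insert ?e (set L)))"
      using rep3 e es marks_insert[OF marks_insert, of es "arrs s3 a_touched" "Field (set L)" "fst ?e" "snd ?e"]
      by (simp_all add: s4 represents_def bits_insert) (cases ?e, simp add: Field_insert insert_commute)
    moreover have "set (fst (try_edge ?e (L, R))) = insert ?e (set L)"
      "snd (try_edge ?e (L, R)) = R"
      using False by (simp_all add: set_try_edge rejected_try_edge)
    moreover have "fst (try_edge ?e (L, R)) = filter (\<lambda>f. fst f \<notin> ?M) L @ ?e # filter (\<lambda>f. fst f \<in> ?M) L"
      using False by (simp add: try_edge.simps Let_def)
    moreover have "length (filter (\<lambda>f. fst f \<notin> ?M) L) + length (filter (\<lambda>f. fst f \<in> ?M) L) = length L"
      using sum_length_filter_compl[of "\<lambda>f. fst f \<in> ?M" L] by simp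
    ultimately show ?thesis
      using r frame rep3 e s3 s4 unfolding st run represents_def by auto
  qed
qed


section \<open>Choosing the next edge\<close>

definition pick :: cmd where
  "pick = Const r_found 1 ;; Move r_edge r_j"

definition scan_step :: cmd where
  "scan_step = Load r_x a_allowed r_j ;; cmd_when (Equal r_x r_one)
     (Load r_x a_decided r_j ;; cmd_when (Equal r_x r_zero)
       (Cond (Equal r_count r_zero) pick
         (Load r_x a_tails r_j ;; Load r_x a_touched r_x ;; Cond (Equal r_x r_one) pick
           (Load r_x a_heads r_j ;; Load r_x a_touched r_x ;; cmd_when (Equal r_x r_one) pick))))"

definition scan :: cmd where
  "scan = Const r_found 0 ;; Loop r_j scan_step"

lemmas scan_defs = scan_def scan_step_def pick_def

lemma run_scan_step:
  assumes rep: "represents es st t" and A: "bits es (arrs t a_allowed) A"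
    and j: "regs t r_j = j" "j < length es"
  shows "regs (run scan_step t) r_found = (if eligible A st (es ! j) then 1 else regs t r_found)"
    and "regs (run scan_step t) r_edge = (if eligible A st (es ! j) then j else regs t r_edge)"
proof -
  obtain L R where st: "st = (L, R)" by fastforce
  have *: "arrs t a_allowed j = of_bool (es ! j \<in> A)" "arrs t a_decided j = of_bool (es ! j \<in> set L \<union> R)"
    "regs t r_count = length L" "regs t r_one = 1" "regs t r_zero = 0"
    "arrs t a_tails j = fst (es ! j)" "arrs t a_heads j = snd (es ! j)"
    "arrs t a_touched (fst (es ! j)) = of_bool (fst (es ! j) \<in> Field (set L))"
    "arrs t a_touched (snd (es ! j)) = of_bool (snd (es ! j) \<in> Field (set L))"
    using rep A j nth_in_Field[of j es]
    by (auto simp: represents_def graph_def bits_def marks_def st)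
  show "regs (run scan_step t) r_found = (if eligible A st (es ! j) then 1 else regs t r_found)"
    and "regs (run scan_step t) r_edge = (if eligible A st (es ! j) then j else regs t r_edge)"
    by (simp_all add: scan_step_def pick_def *[unfolded One_nat_def] j st)
qed

lemma run_scan:
  assumes rep: "represents es st s" and A: "bits es (arrs s a_allowed) A"
  shows "regs (run scan s) r_found = of_bool (filter (eligible A st) es \<noteq> [])" (is ?thesis1)
    and "filter (eligible A st) es \<noteq> [] \<Longrightarrow> regs (run scan s) r_edge < length es \<and>
      es ! regs (run scan s) r_edge = last (filter (eligible A st) es)" (is "_ \<Longrightarrow> ?thesis2")
proof -
  define s1 where "s1 = effect (Const r_found 0) s"
  have rep1: "represents es st s1" using rep by (simp add: s1_def represents_def graph_def)
  let ?F = "\<lambda>j. filter (eligible A st) (take j es)"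
  let ?I = "\<lambda>j t. regs t r_found = of_bool (?F j \<noteq> []) \<and>
    (?F j \<noteq> [] \<longrightarrow> regs t r_edge < length es \<and> es ! regs t r_edge = last (?F j))"
  have m: "regs s1 0 = length es" using rep1 by (simp add: represents_def graph_def)
  have "?I (regs s1 0) (run (Loop r_j scan_step) s1)"
  proof (rule Loop_invariant[where I = ?I], goal_cases)
    case 1
    show ?case by (simp add: scan_step_def pick_def)
  next
    case 2
    show ?case by (simp add: s1_def)
  next
    case (3 j t)
    have j: "j < length es" using 3(1) m by simp
    have "represents es st t"
      using rep1 by (rule represents_unchanged[OF _ 3(4)]) (auto simp: scan_step_def pick_def)
    moreover have "bits es (arrs t a_allowed) A"
      using A unchanged_arr[OF 3(4), of a_allowed] by (simp add: scan_step_def pick_def s1_def)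
    ultimately show ?case
      using run_scan_step[of es st t A j] 3(2,3) j
      by (simp add: take_Suc_conv_app_nth)
  qed
  moreover have "run scan s = run (Loop r_j scan_step) s1" by (simp add: scan_def s1_def)
  ultimately show ?thesis1 "filter (eligible A st) es \<noteq> [] \<Longrightarrow> ?thesis2"
    using m by simp_all
qed

definition round :: cmd where
  "round = scan ;; cmd_when (Equal r_found r_one) attempt"

definition grow_cmd :: cmd where
  "grow_cmd = Loop r_round round"

lemmas grow_cmd_defs = grow_cmd_def round_def scan_defs attempt_defs

lemma run_round:
  assumes rep: "represents es st s" and es: "distinct es" and A: "bits es (arrs s a_allowed) A"
  shows "represents es (grow_step es A st) (run round s)"
proof -
  let ?s = "run scan s"
  have rep1: "represents es st ?s"
    using rep by (rule represents_run) (auto simp: scan_defs)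
  then have "regs ?s r_one = 1" by (simp add: represents_def graph_def)
  then have run: "run round s = (if filter (eligible A st) es \<noteq> [] then run attempt ?s else ?s)"
    using run_scan(1)[OF rep A] by (simp add: round_def)
  show ?thesis
  proof (cases "filter (eligible A st) es = []")
    case True
    then show ?thesis using run rep1 by (simp add: grow_step_def)
  next
    case False
    from run_scan(2)[OF rep A False]
    have e: "regs ?s r_edge < length es" "es ! regs ?s r_edge = last (filter (eligible A st) es)"
      by simp_all
    have "eligible A st (last (filter (eligible A st) es))"
      using last_in_set[OF False] by simp
    then have "es ! regs ?s r_edge \<notin> set (fst st)" unfolding e(2) by (cases st) simp
    then show ?thesis
      using run_attempt[OF rep1 es e(1)] False run e(2) by (simp add: grow_step_def)
  qed
qed

lemma run_grow_cmd:
  assumes rep: "represents es st s" and es: "distinct es" and A: "bits es (arrs s a_allowed) A"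
  shows "represents es (grow es A st) (run grow_cmd s)"
proof -
  let ?I = "\<lambda>j t. represents es ((grow_step es A ^^ j) st) t"
  have m: "regs s 0 = length es" using rep by (simp add: represents_def graph_def)
  have "?I (regs s 0) (run grow_cmd s)"
    unfolding grow_cmd_def
  proof (rule Loop_invariant[where I = ?I], goal_cases)
    case 1
    show ?case by (simp add: round_def scan_defs attempt_defs)
  next
    case 2
    show ?case using rep by (simp add: represents_def graph_def)
  next
    case (3 j t)
    have "arrs t a_allowed = arrs s a_allowed"
      using unchanged_arr[OF 3(4), of a_allowed] by (simp add: round_def scan_defs attempt_defs)
    then have "represents es ((grow_step es A ^^ Suc j) st) (run round t)"
      using run_round[OF 3(2) es, of A] A by simp
    then show ?case by (simp add: represents_def graph_def)
  qed
  then show ?thesis using m by (simp add: grow_def)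
qed

section \<open>The neighbors on the machine\<close>

definition prune_step :: "arr \<Rightarrow> reg \<Rightarrow> cmd" where
  "prune_step a r = Load r_x a r_j ;; Cond (Equal r_x r) (Store a_allowed r_j r_zero)
     (Load r_x a_current r_j ;; Store a_allowed r_j r_x)"

definition prune :: "bool \<Rightarrow> cmd" where
  "prune b = Loop r_j (if b then prune_step a_heads r_tail else prune_step a_tails r_head)"

lemma run_prune:
  assumes g: "graph es s" and S: "bits es (arrs s a_current) S"
    and e: "regs s r_tail = fst e" "regs s r_head = snd e"
  shows "bits es (arrs (run (prune b) s) a_allowed) (pruned b e S)"
proof -
  let ?I = "\<lambda>j t. \<forall>i < j. arrs t a_allowed i = of_bool (es ! i \<in> pruned b e S)"
  have "?I (regs s 0) (run (prune b) s)"
    unfolding prune_def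
  proof (rule Loop_invariant[where I = ?I], goal_cases)
    case 1
    show ?case by (simp add: prune_step_def)
  next
    case (3 j t)
    have "graph es t" using g by (rule graph_unchanged[OF _ 3(4)]) (auto simp: prune_step_def)
    moreover have "j < length es" using 3(1) g by (simp add: graph_def)
    moreover have "arrs t a_current = arrs s a_current" "regs t r_tail = fst e" "regs t r_head = snd e"
      using e unchanged_arr[OF 3(4), of a_current] unchanged_reg[OF 3(4), of r_tail]
        unchanged_reg[OF 3(4), of r_head] by (simp_all add: prune_step_def)
    ultimately show ?case
      using 3(2,3) S by (auto simp: prune_step_def pruned_def graph_def bits_def less_Suc_eq)
  qed simp
  then show ?thesis using g by (simp add: graph_def bits_def)
qed

definition candidate_cmd :: "bool \<Rightarrow> cmd" where
  "candidate_cmd b = reset ;; Move r_edge r_pivot ;; attempt ;; prune b ;; grow_cmd ;;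
     fill a_allowed r_one ;; grow_cmd"

lemmas candidate_cmd_defs = candidate_cmd_def reset_def fill_def grow_cmd_defs prune_def prune_step_def

lemma run_candidate_cmd:
  assumes g: "graph es s" and es: "distinct es" and S: "bits es (arrs s a_current) S"
    and p: "regs s r_pivot < length es"
  shows "bits es (arrs (run (candidate_cmd b) s) a_chosen) (candidate es b (es ! regs s r_pivot) S)"
proof -
  let ?e = "es ! regs s r_pivot"
  define s1 where "s1 = effect (Move r_edge r_pivot) (run reset s)"
  define s2 where "s2 = run attempt s1"
  define s3 where "s3 = run (prune b) s2"
  define s4 where "s4 = run grow_cmd s3"
  define s5 where "s5 = run (fill a_allowed r_one) s4"
  have rep1: "represents es ([], {}) s1"
    using run_reset[OF g] by (simp add: s1_def represents_def graph_def)
  have s1: "regs s1 r_edge = regs s r_pivot"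
    unfolding s1_def using run_reg[of r_pivot reset s] by (simp add: reset_def clear_def fill_def)
  have rep2: "represents es (try_edge ?e ([], {})) s2"
    using run_attempt[OF rep1 es] p s1 by (simp add: s2_def)
  \<comment> \<open>\<open>prune\<close> compares with the endpoint registers that
    \<open>attempt\<close> has loaded; nothing later in \<open>attempt\<close> writes them.\<close>
  have s2: "regs s2 r_tail = fst ?e" "regs s2 r_head = snd ?e"
  proof -
    define s' where "s' = effect (Load r_head a_heads r_edge) (effect (Load r_tail a_tails r_edge) s1)"
    have s': "regs s' r_tail = fst ?e" "regs s' r_head = snd ?e"
      using rep1 p s1 by (auto simp: s'_def represents_def graph_def)
    let ?c = "mark_reach ;; Load r_x a_marked r_tail ;;
      Cond (Equal r_x r_one) (Store a_decided r_edge r_one) accept"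
    have c: "s2 = run ?c s'" by (simp add: s2_def attempt_def s'_def)
    have "r_tail \<notin> written_regs ?c" "r_head \<notin> written_regs ?c" by (simp_all add: attempt_defs)
    from this[THEN run_reg, of s'] show "regs s2 r_tail = fst ?e" "regs s2 r_head = snd ?e"
      unfolding c s' .
  qed
  have "arrs s2 a_current = arrs s1 a_current"
    unfolding s2_def by (rule run_arr) (simp add: attempt_defs)
  also have "\<dots> = arrs (run reset s) a_current" by (simp add: s1_def)
  also have "\<dots> = arrs s a_current"
    by (rule run_arr) (simp add: reset_def clear_def fill_def)
  finally have S2: "bits es (arrs s2 a_current) S" using S by simp
  have g2: "graph es s2" using rep2 by (simp add: represents_def)
  have rep3: "represents es (try_edge ?e ([], {})) s3"
    using rep2 unfolding s3_def by (rule represents_run) (auto simp: prune_def prune_step_def)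
  have rep4: "represents es (grow es (pruned b ?e S) (try_edge ?e ([], {}))) s4"
    using run_grow_cmd[OF rep3 es] run_prune[OF g2 S2 s2] by (simp add: s4_def s3_def)
  have rep5: "represents es (grow es (pruned b ?e S) (try_edge ?e ([], {}))) s5"
    using rep4 unfolding s5_def by (rule represents_run) (auto simp: fill_def)
  have "bits es (arrs s5 a_allowed) UNIV"
    using run_fill[of s4 es r_one True a_allowed] rep4 by (simp add: s5_def represents_def graph_def)
  then have "bits es (arrs s5 a_allowed) (set es)" by (simp add: bits_def)
  from run_grow_cmd[OF rep5 es this]
  have "bits es (arrs (run grow_cmd s5) a_chosen) (candidate es b ?e S)"
    by (simp add: represents_def candidate_def)
  then show ?thesis by (simp add: candidate_cmd_def s5_def s4_def s3_def s2_def s1_def)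
qed

definition initial_cmd :: cmd where
  "initial_cmd = Const r_one 1 ;; reset ;; fill a_allowed r_one ;; grow_cmd"

lemmas initial_cmd_defs = initial_cmd_def reset_def fill_def grow_cmd_defs

text \<open>The counterpart of \<open>graph\<close> for the initial memory, where the constant one
  is not yet set up.\<close>

definition loaded :: "(nat \<times> nat) list \<Rightarrow> state \<Rightarrow> bool" where
  "loaded es s \<longleftrightarrow> regs s 0 = length es \<and> regs s r_zero = 0 \<and>
    (\<forall>j < length es. arrs s a_tails j = fst (es ! j) \<and> arrs s a_heads j = snd (es ! j))"

lemma run_initial_cmd:
  assumes "loaded es s" and es: "distinct es"
  shows "graph es (run initial_cmd s)"
    and "bits es (arrs (run initial_cmd s) a_chosen) (initial_solution es)"
proof -
  define s1 where "s1 = effect (Const r_one 1) s"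
  define s2 where "s2 = run reset s1"
  define s3 where "s3 = run (fill a_allowed r_one) s2"
  have "graph es s1" using assms by (simp add: s1_def loaded_def graph_def)
  then have rep2: "represents es ([], {}) s2" unfolding s2_def by (rule run_reset)
  then have rep3: "represents es ([], {}) s3"
    unfolding s3_def by (rule represents_run) (auto simp: fill_def)
  have "bits es (arrs s3 a_allowed) UNIV"
    using run_fill[of s2 es r_one True a_allowed] rep2 by (simp add: s3_def represents_def graph_def)
  then have "bits es (arrs s3 a_allowed) (set es)" by (simp add: bits_def)
  from run_grow_cmd[OF rep3 es this]
  have "represents es (grow es (set es) ([], {})) (run initial_cmd s)"
    by (simp add: initial_cmd_def s1_def s2_def s3_def)
  then show "graph es (run initial_cmd s)"
    "bits es (arrs (run initial_cmd s) a_chosen) (initial_solution es)"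
    by (simp_all add: represents_def initial_solution_def)
qed

section \<open>Output and expansion\<close>

definition positions :: "'a list \<Rightarrow> 'a set \<Rightarrow> nat list" where
  "positions es S = filter (\<lambda>j. es ! j \<in> S) [0..<length es]"

definition emission :: "'a list \<Rightarrow> 'a set \<Rightarrow> event list" where
  "emission es S = map Out (positions es S) @ [Sep]"

lemma outputs_emission:
  "filter (\<lambda>e. e \<noteq> Tick) tr = concat (map (emission es) Ss) \<Longrightarrow> outputs tr (map (positions es) Ss)"
  by (simp add: outputs_def emission_def[abs_def] o_def)

lemma encodes_positions:
  "S \<subseteq> set es \<Longrightarrow> encodes maximal_connected_dag_problem es (positions es S) S"
  by (auto simp: encodes_def maximal_connected_dag_problem_def positions_def image_iff in_set_conv_nth)
    (metis in_set_conv_nth subsetD)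

lemma list_all2_encodes_positions:
  "\<forall>S \<in> set Ss. S \<subseteq> set es \<Longrightarrow>
    list_all2 (encodes maximal_connected_dag_problem es) (map (positions es) Ss) Ss"
  by (auto simp: list_all2_map1 encodes_positions list.rel_refl_strong)

definition emit_step :: "arr \<Rightarrow> cmd" where
  "emit_step a = Load r_x a r_j ;; cmd_when (Equal r_x r_one) (Put r_j)"

definition emit :: "arr \<Rightarrow> cmd" where
  "emit a = Loop r_j (emit_step a) ;; EndSol"

lemma events_emit:
  assumes g: "graph es s" and S: "bits es (arrs s a) S"
  shows "events (emit a) s = emission es S"
proof -
  let ?I = "\<lambda>j ev t. ev = map Out (filter (\<lambda>j. es ! j \<in> S) [0..<j])"
  have "?I (regs s 0) (events (Loop r_j (emit_step a)) s) (run (Loop r_j (emit_step a)) s)"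
  proof (rule Loop_invariant_events[where I = ?I], goal_cases)
    case 1
    show ?case by (simp add: emit_step_def)
  next
    case (3 j ev t)
    have "graph es t" using g by (rule graph_unchanged[OF _ 3(4)]) (auto simp: emit_step_def)
    moreover have "arrs t a = arrs s a"
      using unchanged_arr[OF 3(4), of a] by (simp add: emit_step_def)
    ultimately show ?case
      using 3 S g by (simp add: emit_step_def graph_def bits_def)
  qed simp
  then show ?thesis using g by (simp add: emit_def emission_def positions_def graph_def)
qed

text \<open>The action is a parameter because two programs share this loop: emitting the candidates
  gives the neighbors, enqueueing them gives the search.\<close>

definition expand :: "cmd \<Rightarrow> cmd" where
  "expand act = Loop r_pivot (candidate_cmd True ;; act ;; candidate_cmd False ;; act)"

definition candidates :: "(nat \<times> nat) list \<Rightarrow> (nat \<times> nat) set \<Rightarrow> nat \<Rightarrow> (nat \<times> nat) set list" where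
  "candidates es S j =
    concat (map (\<lambda>e. [candidate es True e S, candidate es False e S]) (take j es))"

lemma candidates_0 [simp]: "candidates es S 0 = []"
  by (simp add: candidates_def)

lemma candidates_Suc:
  "j < length es \<Longrightarrow> candidates es S (Suc j) =
    candidates es S j @ [candidate es True (es ! j) S, candidate es False (es ! j) S]"
  by (simp add: candidates_def take_Suc_conv_app_nth)

lemma set_candidates: "set (candidates es S (length es)) = neighbors es S"
  by (auto simp: candidates_def neighbors_def) (metis (full_types))+

lemma candidates_maximal:
  "X \<in> set (candidates es S j) \<Longrightarrow> X \<in> maximal_connected_dags (set es)"
  by (auto simp: candidates_def dest!: in_set_takeD intro: candidate_maximal)

lemma unchanged_trans:
  assumes "unchanged c s t" "unchanged d t t'"
    "written_regs d \<subseteq> written_regs c" "written_arrs d \<subseteq> written_arrs c"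
  shows "unchanged c s t'"
  unfolding unchanged_def
proof (intro conjI allI impI)
  fix r assume "r \<notin> written_regs c"
  then show "regs t' r = regs s r" using assms(1,2,3) by (metis subsetD unchanged_reg)
next
  fix a assume "a \<notin> written_arrs c"
  then show "arrs t' a = arrs s a" using assms(1,2,4) by (metis subsetD unchanged_arr)
qed

lemma silent_candidate_cmd: "silent (candidate_cmd b)"
  by (simp add: candidate_cmd_defs)

lemma candidate_cmd_frame:
  "{0, 1, 2, 13, 14, 17, 18, 19, 20, 21, 22, 23} \<inter> written_regs (candidate_cmd b) = {}"
  "{0, 1, 2, 9, 10, 11, 12} \<inter> written_arrs (candidate_cmd b) = {}"
  by (simp_all add: candidate_cmd_defs)

text \<open>\<open>J\<close> collects the effect of the actions on the candidates produced so far.\<close>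

lemma run_expand:
  assumes g: "graph es s" and es: "distinct es" and S: "bits es (arrs s a_current) S"
    and act: "admissible (expand act)"
      "{13, 14} \<inter> written_regs act = {}" "{0, 1, 9} \<inter> written_arrs act = {}"
    and J0: "J [] [] s"
    and J: "\<And>Xs ev b e t. J Xs ev t \<Longrightarrow> graph es t \<Longrightarrow>
      bits es (arrs (run (candidate_cmd b) t) a_chosen) (candidate es b e S) \<Longrightarrow> e \<in> set es \<Longrightarrow>
      J (Xs @ [candidate es b e S]) (ev @ events act (run (candidate_cmd b) t))
        (run act (run (candidate_cmd b) t))"
    and J_cong: "\<And>Xs ev t r v. J Xs ev t \<Longrightarrow> J Xs ev (t\<lparr>regs := (regs t)(r_pivot := v)\<rparr>)"
  shows "J (candidates es S (length es)) (events (expand act) s) (run (expand act) s)"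
proof -
  let ?c = "\<lambda>b. candidate_cmd b ;; act"
  let ?body = "candidate_cmd True ;; act ;; candidate_cmd False ;; act"
  have m: "regs s 0 = length es" using g by (simp add: graph_def)
  have act0: "0 \<notin> written_regs act" "r_pivot \<notin> written_regs act"
    using act(1) by (auto simp: expand_def dest: admissible_reg_0)
  have w: "r \<notin> written_regs (candidate_cmd b)" if "r \<in> {0, r_one, r_zero, r_pivot}" for b r
    using that candidate_cmd_frame(1)[of b] by auto
  have wa: "a \<notin> written_arrs (candidate_cmd b)" if "a \<in> {0, 1, a_current}" for b a
    using that candidate_cmd_frame(2)[of b] by auto
  let ?I = "\<lambda>j ev t. J (candidates es S j) ev t"
  have "?I (regs s 0) (events (expand act) s) (run (expand act) s)"
    unfolding expand_def
  proof (rule Loop_invariant_events[where I = ?I], goal_cases)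
    case 1
    show ?case using act(1) by (simp add: expand_def)
  next
    case 2
    show ?case using J_cong[OF J0] by simp
  next
    case (3 j ev t)
    have j: "j < length es" using 3(1) m by simp
    \<comment> \<open>Each pivot edge gives two candidates; this handles either of them, from any
      state reached within the round.\<close>
    have step: "J (Xs @ [candidate es b (es ! j) S]) (ev @ events (?c b) t') (run (?c b) t')"
      if "J Xs ev t'" "unchanged (Loop r_pivot ?body) s t'" "regs t' r_pivot = j" for Xs ev b t'
    proof -
      have gt: "graph es t'"
        using g by (rule graph_unchanged[OF _ that(2)]) (use w wa act act0 in auto)
      have "arrs t' a_current = arrs s a_current"
        using wa act by (intro unchanged_arr[OF that(2)]) auto
      then have St: "bits es (arrs t' a_current) S" using S by simp
      show ?thesis
        using J[OF that(1) gt, of b "es ! j"] run_candidate_cmd[OF gt es St, of b] that(3) j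
        by (simp add: silent_events silent_candidate_cmd)
    qed
    define t1 where "t1 = run (?c True) t"
    have "unchanged (Loop r_pivot ?body) s t1"
      unfolding t1_def by (rule unchanged_trans[OF 3(4) unchanged_run]) auto
    moreover have "regs t1 r_pivot = j"
      using w act0 unfolding t1_def 3(3)[symmetric] by (intro run_reg) auto
    moreover have "J (candidates es S j @ [candidate es True (es ! j) S]) (ev @ events (?c True) t) t1"
      unfolding t1_def by (rule step[OF 3(2,4,3)])
    ultimately have "J ((candidates es S j @ [candidate es True (es ! j) S]) @ [candidate es False (es ! j) S])
        ((ev @ events (?c True) t) @ events (?c False) t1) (run (?c False) t1)"
      by (intro step)
    \<comment> \<open>The loop increments its counter after the body, a change to which
      \<open>J\<close> has to be insensitive.\<close>
    from J_cong[OF this, of "Suc (regs (run (?c False) t1) r_pivot)"] show ?case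
      using j by (simp add: candidates_Suc t1_def)
  qed
  then show ?thesis using m by simp
qed

section \<open>The two polynomial-time programs\<close>

lemma cost_bigo: "(\<lambda>n. real (k * cost n c)) \<in> O(\<lambda>n. real n ^ depth c)"
proof -
  obtain K where K: "\<And>m. cost m c \<le> K * Suc m ^ depth c" using cost_le[of c] by blast
  have "(\<lambda>n. real (k * cost n c)) \<in> O(\<lambda>n. real ((k * K) * Suc n ^ depth c))"
  proof (rule landau_o.big_mono, intro always_eventually allI)
    fix n
    have "k * cost n c \<le> (k * K) * Suc n ^ depth c" using K[of n] by (simp add: mult.assoc)
    then show "norm (real (k * cost n c)) \<le> norm (real ((k * K) * Suc n ^ depth c))"
      by (simp only: real_norm_def abs_of_nat of_nat_le_iff)
  qed
  also have "(\<lambda>n. real ((k * K) * Suc n ^ depth c)) \<in> O(\<lambda>n. real n ^ depth c)"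
    by (rule power_Suc_bigo)
  finally show ?thesis .
qed

lemma polynomially_bounded_cost: "polynomially_bounded (\<lambda>n. cost n c)"
  unfolding polynomially_bounded_def using cost_bigo[of 1 c] by auto

lemma loaded_init:
  "loaded es (init (input maximal_connected_dag_problem es))"
  "loaded es (init (input maximal_connected_dag_problem es @ [xs]))"
  by (auto simp: loaded_def init_def maximal_connected_dag_problem_def nth_append)

lemma problem_simps:
  "instances maximal_connected_dag_problem = {es. distinct es}"
  "universe maximal_connected_dag_problem es = set es"
  "solutions maximal_connected_dag_problem es = maximal_connected_dags (set es)"
  by (simp_all add: maximal_connected_dag_problem_def universe_def)

lemma maximal_connected_dags_subset: "F \<in> maximal_connected_dags E \<Longrightarrow> F \<subseteq> E"
  by (simp add: maximal_connected_dags_def)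

section \<open>Finding one solution\<close>

definition find_cmd :: cmd where
  "find_cmd = initial_cmd ;; emit a_chosen"

lemma admissible_find_cmd: "admissible find_cmd"
  by (simp add: find_cmd_def initial_cmd_defs emit_def emit_step_def)

lemma silent_initial_cmd: "silent initial_cmd"
  by (simp add: initial_cmd_defs)

lemma solution_findable: "solution_findable maximal_connected_dag_problem"
  unfolding solution_findable_def problem_simps
proof (intro exI[of _ "compile find_cmd"] exI[of _ "\<lambda>n. cost n find_cmd"] conjI ballI)
  show "polynomially_bounded (\<lambda>n. cost n find_cmd)" by (rule polynomially_bounded_cost)
next
  fix es :: "(nat \<times> nat) list" assume "es \<in> {es. distinct es}"
  then have es: "distinct es" by simp
  let ?s = "init (input maximal_connected_dag_problem es)"
  have "loaded es ?s" by (rule loaded_init)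
  note init = run_initial_cmd[OF this es]
  have "regs ?s 0 = length es" using loaded_init(1)[of es] by (simp add: loaded_def)
  from exec_compile[OF admissible_find_cmd this] obtain tr where
    tr: "exec (compile find_cmd) ?s tr (run find_cmd ?s)"
      "filter (\<lambda>e. e \<noteq> Tick) tr = events find_cmd ?s" "length tr \<le> cost (length es) find_cmd"
    by blast
  have "events find_cmd ?s = emission es (initial_solution es)"
    using events_emit[OF init] by (simp add: find_cmd_def silent_events silent_initial_cmd)
  then have "outputs tr [positions es (initial_solution es)]"
    using outputs_emission[of tr es "[initial_solution es]"] tr(2) by simp
  moreover have "initial_solution es \<in> maximal_connected_dags (set es)"
    by (rule initial_solution_maximal)
  moreover note encodes_positions[OF maximal_connected_dags_subset[OF this]]
  ultimately show "\<exists>tr t xs S. exec (compile find_cmd) ?s tr t \<and>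
      length tr \<le> cost (card (set es)) find_cmd \<and> outputs tr [xs] \<and>
      encodes maximal_connected_dag_problem es xs S \<and> S \<in> maximal_connected_dags (set es)"
    using tr(1,3) distinct_card[OF es] by metis
qed

section \<open>The neighbors of a given solution\<close>

definition load_step :: cmd where
  "load_step = cmd_when (Less r_j r_given) (Load r_x a_given r_j ;; Store a_current r_x r_one)"

definition load_given :: cmd where
  "load_given = Const r_one 1 ;; fill a_current r_zero ;; Loop r_j load_step"

lemma run_load_given:
  assumes loaded: "loaded es s" and es: "distinct es"
    and given: "regs s r_given = length xs" "\<And>j. j < length xs \<Longrightarrow> arrs s a_given j = xs ! j"
    and xs: "encodes maximal_connected_dag_problem es xs S"
  shows "graph es (run load_given s)" and "bits es (arrs (run load_given s) a_current) S"
proof -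
  have xs: "distinct xs" "set xs \<subseteq> {..<length es}" "S = (\<lambda>k. es ! k) ` set xs"
    using xs by (simp_all add: encodes_def maximal_connected_dag_problem_def)
  define s1 where "s1 = effect (Const r_one 1) s"
  define s2 where "s2 = run (fill a_current r_zero) s1"
  have g1: "graph es s1" using loaded by (simp add: s1_def loaded_def graph_def)
  then have g2: "graph es s2" unfolding s2_def by (rule graph_run) (auto simp: fill_def)
  have b2: "bits es (arrs s2 a_current) {}"
    using run_fill[of s1 es r_zero False a_current] g1 by (simp add: s2_def graph_def)
  have given2: "regs s2 r_given = length xs" "arrs s2 a_given = arrs s a_given"
    using given by (simp_all add: s2_def s1_def run_reg run_arr fill_def)
  let ?I = "\<lambda>j t. \<forall>i < length es. arrs t a_current i = of_bool (i \<in> set (take j xs))"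
  have "?I (regs s2 0) (run (Loop r_j load_step) s2)"
  proof (rule Loop_invariant[where I = ?I], goal_cases)
    case 1
    show ?case by (simp add: load_step_def)
  next
    case 2
    show ?case using b2 by (simp add: bits_def)
  next
    case (3 j t)
    have gt: "graph es t" using g2 by (rule graph_unchanged[OF _ 3(4)]) (auto simp: load_step_def)
    have t: "regs t r_given = length xs" "arrs t a_given = arrs s a_given"
      using given2 unchanged_reg[OF 3(4), of r_given] unchanged_arr[OF 3(4), of a_given]
      by (simp_all add: load_step_def)
    show ?case
    proof (cases "j < length xs")
      case False
      then show ?thesis using 3(2,3) t by (simp add: load_step_def)
    next
      case True
      then show ?thesis
        using 3(2,3) t given(2)[OF True] gt
        by (auto simp: load_step_def take_Suc_conv_app_nth graph_def)
    qed
  qed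
  \<comment> \<open>\<open>xs\<close> consists of distinct positions in \<open>es\<close>, so one
    round per edge reads all of it.\<close>
  moreover have "length xs \<le> length es"
    using xs(1,2) by (metis card_lessThan card_mono distinct_card finite_lessThan)
  then have "length xs \<le> regs s2 0" using g2 by (simp add: graph_def)
  moreover have run: "run load_given s = run (Loop r_j load_step) s2"
    by (simp add: load_given_def s2_def s1_def)
  ultimately have "\<forall>i < length es. arrs (run load_given s) a_current i = of_bool (i \<in> set xs)"
    by simp
  moreover have "es ! i \<in> S \<longleftrightarrow> i \<in> set xs" if "i < length es" for i
    using xs that es by (auto simp: nth_eq_iff_index_eq)
  ultimately show "bits es (arrs (run load_given s) a_current) S" by (simp add: bits_def)
  show "graph es (run load_given s)"
    unfolding run using g2 by (rule graph_run) (auto simp: load_step_def)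
qed

definition neighbors_cmd :: cmd where
  "neighbors_cmd = load_given ;; expand (emit a_chosen)"

lemma admissible_candidate_cmd: "admissible (candidate_cmd b)"
  by (simp add: candidate_cmd_defs)

lemma admissible_expand:
  "admissible act \<Longrightarrow> r_pivot \<notin> written_regs act \<Longrightarrow> admissible (expand act)"
  using candidate_cmd_frame(1)[of True] candidate_cmd_frame(1)[of False]
  by (simp add: expand_def admissible_candidate_cmd)

lemma emit_frame: "written_regs (emit a) = {r_j, r_x}" "written_arrs (emit a) = {}"
  by (auto simp: emit_def emit_step_def)

lemma admissible_neighbors_cmd: "admissible neighbors_cmd"
proof -
  have "admissible load_given" by (simp add: load_given_def load_step_def fill_def)
  moreover have "admissible (expand (emit a_chosen))"
    by (rule admissible_expand) (simp_all add: emit_def emit_step_def)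
  ultimately show ?thesis by (simp add: neighbors_cmd_def)
qed

lemma events_expand_emit:
  assumes g: "graph es s" and es: "distinct es" and S: "bits es (arrs s a_current) S"
  shows "events (expand (emit a_chosen)) s =
    concat (map (emission es) (candidates es S (length es)))"
proof -
  let ?J = "\<lambda>Xs ev t :: state. ev = concat (map (emission es) Xs)"
  show ?thesis
  proof (rule run_expand[OF g es S, where J = ?J])
    show "admissible (expand (emit a_chosen))"
      using admissible_neighbors_cmd by (simp add: neighbors_cmd_def)
  next
    fix Xs ev b e t
    assume "graph es t"
    then have "graph es (run (candidate_cmd b) t)"
      using candidate_cmd_frame[of b] by (intro graph_run[of es t]) auto
    moreover assume "bits es (arrs (run (candidate_cmd b) t) a_chosen) (candidate es b e S)"
      "ev = concat (map (emission es) Xs)"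
    ultimately show "ev @ events (emit a_chosen) (run (candidate_cmd b) t) =
        concat (map (emission es) (Xs @ [candidate es b e S]))"
      by (simp add: events_emit)
  qed (simp_all add: emit_frame)
qed

lemma neighbors_computable:
  "neighbors_computable maximal_connected_dag_problem neighbors"
  unfolding neighbors_computable_def problem_simps
proof (intro exI[of _ "compile neighbors_cmd"] exI[of _ "\<lambda>n. cost n neighbors_cmd"] conjI ballI allI impI)
  show "polynomially_bounded (\<lambda>n. cost n neighbors_cmd)" by (rule polynomially_bounded_cost)
next
  fix es :: "(nat \<times> nat) list" and S xs
  assume "es \<in> {es. distinct es}" and xs: "encodes maximal_connected_dag_problem es xs S"
  then have es: "distinct es" by simp
  let ?s = "init (input maximal_connected_dag_problem es @ [xs])"
  have loaded: "loaded es ?s" by (rule loaded_init)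
  have "regs ?s r_given = length xs" "\<And>j. j < length xs \<Longrightarrow> arrs ?s a_given j = xs ! j"
    by (auto simp: init_def maximal_connected_dag_problem_def nth_append)
  note load = run_load_given[OF loaded es this xs]
  have "regs ?s 0 = length es" using loaded by (simp add: loaded_def)
  from exec_compile[OF admissible_neighbors_cmd this] obtain tr where
    tr: "exec (compile neighbors_cmd) ?s tr (run neighbors_cmd ?s)"
      "filter (\<lambda>e. e \<noteq> Tick) tr = events neighbors_cmd ?s" "length tr \<le> cost (length es) neighbors_cmd"
    by blast
  let ?Ss = "candidates es S (length es)"
  have "silent load_given" by (simp add: load_given_def load_step_def fill_def)
  then have "events neighbors_cmd ?s = concat (map (emission es) ?Ss)"
    using events_expand_emit[OF load(1) es load(2)] by (simp add: neighbors_cmd_def silent_events)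
  then have "outputs tr (map (positions es) ?Ss)"
    using outputs_emission[of tr es ?Ss] tr(2) by simp
  moreover have "list_all2 (encodes maximal_connected_dag_problem es) (map (positions es) ?Ss) ?Ss"
    by (intro list_all2_encodes_positions ballI)
      (blast dest: candidates_maximal maximal_connected_dags_subset)
  ultimately show "\<exists>tr t yss Ss. exec (compile neighbors_cmd) ?s tr t \<and>
      length tr \<le> cost (card (set es)) neighbors_cmd \<and> outputs tr yss \<and>
      list_all2 (encodes maximal_connected_dag_problem es) yss Ss \<and> set Ss = neighbors es S"
    using tr(1,3) distinct_card[OF es] set_candidates[of es S] by metis
qed

lemma proximity_searchable: "proximity_searchable maximal_connected_dag_problem"
  unfolding proximity_searchable_def
proof (intro conjI exI[of _ "\<lambda>_. proximity"] exI[of _ neighbors] ballI impI)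
  show "solution_findable maximal_connected_dag_problem" by (rule solution_findable)
  show "neighbors_computable maximal_connected_dag_problem neighbors" by (rule neighbors_computable)
next
  fix es S F
  assume "F \<in> solutions maximal_connected_dag_problem es"
  then show "proximity S F \<subseteq> universe maximal_connected_dag_problem es"
    using proximity_subset maximal_connected_dags_subset unfolding problem_simps by blast
next
  fix es S
  show "neighbors es S \<subseteq> solutions maximal_connected_dag_problem es"
    unfolding problem_simps by (rule neighbors_maximal)
next
  fix es S F
  assume "S \<in> solutions maximal_connected_dag_problem es"
    "F \<in> solutions maximal_connected_dag_problem es" "S \<noteq> F"
  then show "\<exists>S' \<in> neighbors es S. card (proximity S F) < card (proximity S' F)"
    unfolding problem_simps by (rule exists_closer_neighbor)
qed

section \<open>A trie of the solutions found\<close>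

abbreviation (input) "r_node \<equiv> 18 :: reg"
abbreviation (input) "r_new \<equiv> 19 :: reg"
abbreviation (input) "r_cell \<equiv> 20 :: reg"
abbreviation (input) "r_fresh \<equiv> 21 :: reg"
abbreviation (input) "r_front \<equiv> 22 :: reg"
abbreviation (input) "r_back \<equiv> 23 :: reg"

abbreviation (input) "a_left \<equiv> 10 :: arr"
abbreviation (input) "a_right \<equiv> 11 :: arr"
abbreviation (input) "a_queue \<equiv> 12 :: arr"

text \<open>Node \<open>i\<close> of the trie stands for the word \<open>ws ! i\<close>. The root is node 0; as it is nobody's
  child, 0 also stands for a missing child.\<close>

definition trie :: "bool list list \<Rightarrow> (bool \<Rightarrow> nat \<Rightarrow> nat) \<Rightarrow> bool" where
  "trie ws child \<longleftrightarrow> ws \<noteq> [] \<and> ws ! 0 = [] \<and> distinct ws \<and>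
    (\<forall>w b. w @ [b] \<in> set ws \<longrightarrow> w \<in> set ws) \<and>
    (\<forall>i b. length ws \<le> i \<longrightarrow> child b i = 0) \<and>
    (\<forall>i < length ws. \<forall>b. if child b i = 0 then ws ! i @ [b] \<notin> set ws
       else child b i < length ws \<and> ws ! child b i = ws ! i @ [b])"

lemma trie_singleton: "trie [[]] (\<lambda>_ _. 0)"
  by (simp add: trie_def)

lemma trie_prefix:
  "trie ws child \<Longrightarrow> v @ w \<in> set ws \<Longrightarrow> v \<in> set ws"
  by (induction w rule: rev_induct) (auto simp: trie_def simp flip: append_assoc)

lemma trie_extend:
  assumes t: "trie ws child" and i: "i < length ws" "child b i = 0"
  shows "trie (ws @ [ws ! i @ [b]]) (child(b := (child b)(i := length ws)))"
proof -
  have new: "ws ! i @ [b] \<notin> set ws" using t i by (auto simp: trie_def)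
  have ne: "i \<noteq> length ws" "ws \<noteq> []" using i by auto
  \<comment> \<open>The words are closed under prefixes, so an extension of the new word would have
    brought the new word with it.\<close>
  have ext: "ws ! i @ [b] @ [c] \<notin> set ws" for c
    using new t unfolding trie_def by (metis append_assoc)
  have inj: "ws ! j = ws ! i \<longleftrightarrow> j = i" if "j < length ws" for j
    using t i that by (auto simp: trie_def nth_eq_iff_index_eq)
  show ?thesis
    unfolding trie_def
  proof (intro conjI allI impI)
    fix w c assume "w @ [c] \<in> set (ws @ [ws ! i @ [b]])"
    then show "w \<in> set (ws @ [ws ! i @ [b]])"
      using t i by (auto simp: trie_def)
  next
    fix j c assume j: "j < length (ws @ [ws ! i @ [b]])"
    let ?child = "child(b := (child b)(i := length ws))"
    show "if ?child c j = 0 then (ws @ [ws ! i @ [b]]) ! j @ [c] \<notin> set (ws @ [ws ! i @ [b]])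
      else ?child c j < length (ws @ [ws ! i @ [b]]) \<and>
        (ws @ [ws ! i @ [b]]) ! ?child c j = (ws @ [ws ! i @ [b]]) ! j @ [c]"
    proof (cases "j = length ws")
      case True
      \<comment> \<open>Child cells beyond the last node are still zero: a new node starts without
        children and needs no initialization.\<close>
      then have "?child c j = 0" using t ne by (auto simp: trie_def)
      then show ?thesis using True ext by simp
    next
      case False
      then have j': "j < length ws" using j by simp
      show ?thesis
      proof (cases "c = b \<and> j = i")
        case True
        then show ?thesis using ne i by (simp add: nth_append)
      next
        case False
        have "?child c j = child c j" using False by auto
        moreover have "if child c j = 0 then ws ! j @ [c] \<notin> set ws
            else child c j < length ws \<and> ws ! child c j = ws ! j @ [c]"
          using t j' unfolding trie_def by blast
        moreover have "ws ! j @ [c] \<noteq> ws ! i @ [b]" using False inj[OF j'] by auto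
        ultimately show ?thesis using j' by (auto simp: nth_append split: if_splits)
      qed
    qed
  qed (use t new i in \<open>auto simp: trie_def nth_append\<close>)
qed

text \<open>\<open>r_fresh\<close> is the last node in use, not the next free one; thus zeroed
  memory already is the trie consisting of the root.\<close>

definition trie_state :: "bool list list \<Rightarrow> state \<Rightarrow> bool" where
  "trie_state ws s \<longleftrightarrow> Suc (regs s r_fresh) = length ws \<and>
    trie ws (\<lambda>b. arrs s (if b then a_right else a_left))"

lemma trie_state_cong:
  assumes "regs t r_fresh = regs s r_fresh" "arrs t a_left = arrs s a_left"
    "arrs t a_right = arrs s a_right"
  shows "trie_state ws t = trie_state ws s"
proof -
  have "arrs t (if b then a_right else a_left) = arrs s (if b then a_right else a_left)" for b
    using assms by simp
  then show ?thesis using assms(1) unfolding trie_state_def by simp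
qed

definition descend :: "arr \<Rightarrow> cmd" where
  "descend a = Load r_y a r_node ;;
     cmd_when (Equal r_y r_zero) (Inc r_fresh ;; Move r_y r_fresh ;; Store a r_node r_y ;; Const r_new 1) ;;
     Move r_node r_y"

lemma run_descend:
  fixes b :: bool
  defines "a \<equiv> if b then a_right else a_left"
  assumes t: "trie_state ws s" and i: "regs s r_node < length ws" and z: "regs s r_zero = 0"
  defines "w \<equiv> ws ! regs s r_node @ [b]" and "s' \<equiv> run (descend a) s"
  shows "\<exists>ws'. trie_state ws' s' \<and> set ws' = insert w (set ws) \<and>
    regs s' r_node < length ws' \<and> ws' ! regs s' r_node = w \<and>
    regs s' r_new = (if w \<in> set ws then regs s r_new else 1)"
proof -
  let ?child = "\<lambda>b. arrs s (if b then a_right else a_left)"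
  let ?i = "regs s r_node"
  have child: "arrs s a ?i = ?child b ?i" by (simp add: a_def)
  have tr: "trie ws ?child" "Suc (regs s r_fresh) = length ws" using t by (simp_all add: trie_state_def)
  have if_child: "if ?child b ?i = 0 then w \<notin> set ws else ?child b ?i < length ws \<and> ws ! ?child b ?i = w"
    using tr(1) i unfolding trie_def w_def by blast
  show ?thesis
  proof (cases "?child b ?i = 0")
    case False
    then have "?child b ?i < length ws" "ws ! ?child b ?i = w" "w \<in> set ws"
      using if_child by (auto split: if_splits)
    moreover have "regs s' r_node = ?child b ?i" "regs s' r_fresh = regs s r_fresh"
      "regs s' r_new = regs s r_new" "arrs s' = arrs s"
      using False child z by (simp_all add: s'_def descend_def)
    ultimately show ?thesis
      using t by (intro exI[of _ ws]) (auto simp: trie_state_def)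
  next
    case True
    then have new: "w \<notin> set ws" using if_child by simp
    have "regs s' r_fresh = length ws" "regs s' r_node = length ws" "regs s' r_new = 1"
      "arrs s' = (arrs s)(a := (arrs s a)(?i := length ws))"
      using True child z tr(2) by (simp_all add: s'_def descend_def)
    moreover have "(\<lambda>c. ((arrs s)(a := (arrs s a)(?i := length ws))) (if c then a_right else a_left)) =
        ?child(b := (?child b)(?i := length ws))"
      by (auto simp: a_def fun_eq_iff)
    ultimately show ?thesis
      using trie_extend[OF tr(1) i True] new
      by (intro exI[of _ "ws @ [w]"]) (simp add: trie_state_def w_def)
  qed
qed

text \<open>The bits are written behind the end of the queue during the descent. Whether they count
  is settled afterwards by moving \<open>r_back\<close> or not, so a known solution leaves nothing
  to undo.\<close>

definition insert_step :: cmd where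
  "insert_step = Load r_x a_chosen r_j ;; Store a_queue r_cell r_x ;; Inc r_cell ;;
     Cond (Equal r_x r_one) (descend a_right) (descend a_left)"

definition insert_cmd :: cmd where
  "insert_cmd = Const r_node 0 ;; Move r_cell r_back ;; Loop r_j insert_step"

definition enqueue :: "nat \<Rightarrow> cmd" where
  "enqueue n = Const r_new n ;; insert_cmd ;;
     cmd_when (Equal r_new r_one) (Inc r_cell ;; Move r_back r_cell)"

lemmas enqueue_defs = enqueue_def insert_cmd_def insert_step_def descend_def

definition word :: "'a list \<Rightarrow> 'a set \<Rightarrow> bool list" where
  "word es S = map (\<lambda>e. e \<in> S) es"

lemma word_eq_iff: "S \<subseteq> set es \<Longrightarrow> T \<subseteq> set es \<Longrightarrow> word es S = word es T \<longleftrightarrow> S = T"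
  by (auto simp: word_def)

lemma run_insert_cmd:
  assumes g: "graph es s" and S: "bits es (arrs s a_chosen) S" and t: "trie_state ws s"
    and n: "regs s r_new = of_bool n"
  defines "s' \<equiv> run insert_cmd s"
  shows "\<exists>ws'. trie_state ws' s' \<and> (\<forall>T. word es T \<in> set ws' \<longleftrightarrow> word es T \<in> set ws \<or> word es T = word es S)"
    and "regs s' r_new = of_bool (n \<or> word es S \<notin> set ws)"
    and "regs s' r_cell = regs s r_back + length es"
    and "\<And>i. i < regs s r_back \<Longrightarrow> arrs s' a_queue i = arrs s a_queue i"
    and "\<And>j. j < length es \<Longrightarrow> arrs s' a_queue (regs s r_back + j) = of_bool (es ! j \<in> S)"
proof -
  define s1 where "s1 = effect (Move r_cell r_back) (effect (Const r_node 0) s)"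
  let ?w = "word es S"
  have g1: "graph es s1" using g by (simp add: s1_def graph_def)
  have S1: "bits es (arrs s1 a_chosen) S" using S by (simp add: s1_def)
  have m: "regs s1 0 = length es" using g1 by (simp add: graph_def)
  have t1: "trie_state ws s1" using t by (simp add: s1_def trie_state_def)
  have root: "ws ! 0 = []" "0 < length ws" using t by (simp_all add: trie_state_def trie_def)
  then have root': "[] \<in> set ws" using nth_mem[of 0 ws] by simp
  let ?I = "\<lambda>j u. (\<exists>ws'. trie_state ws' u \<and> set ws' = set ws \<union> {take i ?w | i. i \<le> j} \<and>
      regs u r_node < length ws' \<and> ws' ! regs u r_node = take j ?w) \<and>
    regs u r_new = of_bool (n \<or> take j ?w \<notin> set ws) \<and>
    regs u r_cell = regs s r_back + j \<and>
    (\<forall>i < regs s r_back. arrs u a_queue i = arrs s a_queue i) \<and>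
    (\<forall>i < j. arrs u a_queue (regs s r_back + i) = of_bool (es ! i \<in> S))"
  have "?I (regs s1 0) (run (Loop r_j insert_step) s1)"
  proof (rule Loop_invariant[where I = ?I], goal_cases)
    case 1
    show ?case by (simp add: insert_step_def descend_def)
  next
    case 2
    have "trie_state ws (effect (Const r_j 0) s1)" using t1 by (simp add: trie_state_def)
    moreover have "set ws = set ws \<union> {take i ?w | i. i \<le> 0}" using root' by auto
    ultimately show ?case using root root' n by (auto simp: s1_def)
  next
    case (3 j u)
    have j: "j < length es" using 3(1) m by simp
    then have w: "take (Suc j) ?w = take j ?w @ [es ! j \<in> S]"
      by (simp add: word_def take_Suc_conv_app_nth)
    obtain ws' where ws': "trie_state ws' u" "set ws' = set ws \<union> {take i ?w | i. i \<le> j}"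
      "regs u r_node < length ws'" "ws' ! regs u r_node = take j ?w" using 3(2) by blast
    have gu: "graph es u"
      using g1 by (rule graph_unchanged[OF _ 3(4)]) (auto simp: insert_step_def descend_def)
    have "arrs u a_chosen = arrs s1 a_chosen"
      using unchanged_arr[OF 3(4), of a_chosen] by (simp add: insert_step_def descend_def)
    then have c: "arrs u a_chosen j = of_bool (es ! j \<in> S)" using S1 j by (simp add: bits_def)
    define b where "b = (es ! j \<in> S)"
    define u1 where "u1 = effect (Inc r_cell) (effect (Store a_queue r_cell r_x) (effect (Load r_x a_chosen r_j) u))"
    define u2 where "u2 = run (descend (if b then a_right else a_left)) u1"
    have run: "run insert_step u = u2"
      using 3(3) c gu by (simp add: insert_step_def u2_def u1_def b_def graph_def)
    have "trie_state ws' u1 = trie_state ws' u" by (rule trie_state_cong) (simp_all add: u1_def)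
    then have u1: "trie_state ws' u1" "regs u1 r_node = regs u r_node" "regs u1 r_zero = 0"
      "regs u1 r_new = regs u r_new" "regs u1 r_cell = regs s r_back + Suc j"
      "arrs u1 a_queue = (arrs u a_queue)(regs s r_back + j := of_bool b)"
      using ws'(1) gu 3(2,3) c by (simp_all add: u1_def graph_def b_def)
    obtain ws'' where ws'': "trie_state ws'' u2" "set ws'' = insert (take (Suc j) ?w) (set ws')"
      "regs u2 r_node < length ws''" "ws'' ! regs u2 r_node = take (Suc j) ?w"
      "regs u2 r_new = (if take (Suc j) ?w \<in> set ws' then regs u r_new else 1)"
      using run_descend[OF u1(1), of b] ws'(3,4) u1 w unfolding u2_def b_def by auto
    have u2: "regs u2 r_cell = regs u1 r_cell" "arrs u2 a_queue = arrs u1 a_queue"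
      by (simp_all add: u2_def run_reg run_arr descend_def)
    \<comment> \<open>The prefixes inserted so far are shorter, so they cannot make the next prefix
      look known.\<close>
    have "take (Suc j) ?w \<in> set ws' \<longleftrightarrow> take (Suc j) ?w \<in> set ws"
      using j unfolding ws'(2) by (auto simp: word_def dest: arg_cong[of _ _ length])
    \<comment> \<open>Once a prefix is missing from the old trie, all longer ones are missing too,
      so the flag set at the first missing prefix is right for the whole word.\<close>
    moreover have "take j ?w \<in> set ws" if "take (Suc j) ?w \<in> set ws"
      using that t w trie_prefix[of ws _ "take j ?w" "[es ! j \<in> S]"] by (auto simp: trie_state_def)
    ultimately have new: "regs u2 r_new = of_bool (n \<or> take (Suc j) ?w \<notin> set ws)"
      using ws''(5) 3(2) by auto
    have "set ws'' = set ws \<union> {take i ?w | i. i \<le> Suc j}"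
      unfolding ws''(2) ws'(2) by (auto simp: le_Suc_eq)
    moreover have "trie_state ws'' (effect (Inc r_j) u2)" using ws''(1) by (simp add: trie_state_def)
    ultimately have "\<exists>ws''. trie_state ws'' (effect (Inc r_j) u2) \<and>
        set ws'' = set ws \<union> {take i ?w | i. i \<le> Suc j} \<and>
        regs (effect (Inc r_j) u2) r_node < length ws'' \<and> ws'' ! regs (effect (Inc r_j) u2) r_node = take (Suc j) ?w"
      using ws''(3,4) by (intro exI[of _ ws'']) simp
    then show ?case
      using new u2 u1 3(2) unfolding run by (simp add: less_Suc_eq b_def)
  qed
  moreover have "s' = run (Loop r_j insert_step) s1" by (simp add: s'_def insert_cmd_def s1_def)
  ultimately have I: "?I (length es) s'" using m by simp
  have len: "length (word es T) = length es" for T by (simp add: word_def)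
  obtain ws' where "trie_state ws' s'" "set ws' = set ws \<union> {take i ?w | i. i \<le> length es}"
    using I by blast
  \<comment> \<open>All words of edge sets have the same length, so the proper prefixes that were
    inserted stand for no edge set.\<close>
  moreover have "word es T \<in> {take i ?w | i. i \<le> length es} \<longleftrightarrow> word es T = ?w" for T
    using len[of S] len[of T] by (auto dest: arg_cong[of _ _ length] intro: exI[of _ "length es"])
  ultimately show "\<exists>ws'. trie_state ws' s' \<and>
      (\<forall>T. word es T \<in> set ws' \<longleftrightarrow> word es T \<in> set ws \<or> word es T = ?w)" by auto
  show "regs s' r_new = of_bool (n \<or> ?w \<notin> set ws)" using I len[of S] by simp
  show "regs s' r_cell = regs s r_back + length es"
    "\<And>i. i < regs s r_back \<Longrightarrow> arrs s' a_queue i = arrs s a_queue i"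
    "\<And>j. j < length es \<Longrightarrow> arrs s' a_queue (regs s r_back + j) = of_bool (es ! j \<in> S)"
    using I by simp_all
qed

section \<open>Listing by breadth-first search\<close>

text \<open>The \<open>k\<close>-th solution found occupies \<open>length es + 1\<close> cells of the queue, so that the front stays
  behind the back even if there are no edges.\<close>

definition store :: "(nat \<times> nat) list \<Rightarrow> (nat \<times> nat) set list \<Rightarrow> state \<Rightarrow> bool" where
  "store es Q s \<longleftrightarrow> distinct Q \<and> (\<forall>S \<in> set Q. S \<subseteq> set es) \<and>
    (\<exists>ws. trie_state ws s \<and> (\<forall>S. S \<subseteq> set es \<longrightarrow> word es S \<in> set ws \<longleftrightarrow> S \<in> set Q)) \<and>
    regs s r_back = length Q * Suc (length es) \<and>
    (\<forall>k < length Q. \<forall>j < length es.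
      arrs s a_queue (k * Suc (length es) + j) = of_bool (es ! j \<in> Q ! k))"

lemma store_unchanged:
  assumes "store es Q s" "unchanged c s t" "{21, 23} \<inter> written_regs c = {}"
    "{10, 11, 12} \<inter> written_arrs c = {}"
  shows "store es Q t"
proof -
  have "regs t 21 = regs s 21" "regs t 23 = regs s 23"
    "arrs t 10 = arrs s 10" "arrs t 11 = arrs s 11" "arrs t 12 = arrs s 12"
    using assms by (auto simp: unchanged_def)
  moreover from this have "trie_state ws t = trie_state ws s" for ws
    by (intro trie_state_cong)
  ultimately show ?thesis using assms(1) by (simp add: store_def)
qed

lemmas store_run = store_unchanged[OF _ unchanged_run]

lemma cell_less:
  "k < n \<Longrightarrow> j < m \<Longrightarrow> k * Suc m + j < n * Suc (m :: nat)"
  using mult_le_mono1[of "Suc k" n "Suc m"] by simp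

text \<open>The first solution is enqueued even if, for want of edges, its word is the empty word, which
  is in the trie from the beginning.\<close>

lemma run_enqueue:
  assumes g: "graph es s" and S: "bits es (arrs s a_chosen) S" "S \<subseteq> set es"
    and Q: "distinct Q" "\<forall>S \<in> set Q. S \<subseteq> set es"
    and t: "trie_state ws s"
    and ws: "\<forall>T. T \<subseteq> set es \<longrightarrow> word es T \<in> set ws \<longrightarrow> T \<in> set Q \<or> n \<and> T = S"
      "\<forall>T \<in> set Q. word es T \<in> set ws" "n \<Longrightarrow> S \<notin> set Q"
    and rear: "regs s r_back = length Q * Suc (length es)"
    and queue: "\<forall>k < length Q. \<forall>j < length es.
      arrs s a_queue (k * Suc (length es) + j) = of_bool (es ! j \<in> Q ! k)"
  shows "store es (if S \<in> set Q then Q else Q @ [S]) (run (enqueue (of_bool n)) s)"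
proof -
  define s1 where "s1 = effect (Const r_new (of_bool n)) s"
  define s2 where "s2 = run insert_cmd s1"
  have s1: "graph es s1" "bits es (arrs s1 a_chosen) S" "trie_state ws s1" "regs s1 r_new = of_bool n"
    "regs s1 r_back = length Q * Suc (length es)" "arrs s1 a_queue = arrs s a_queue"
    using g S(1) t rear by (simp_all add: s1_def graph_def trie_state_def)
  note ins = run_insert_cmd[OF s1(1-4), folded s2_def]
  obtain ws' where ws': "trie_state ws' s2"
    "\<forall>T. word es T \<in> set ws' \<longleftrightarrow> word es T \<in> set ws \<or> word es T = word es S" using ins(1) by blast
  have new: "n \<or> word es S \<notin> set ws \<longleftrightarrow> S \<notin> set Q" using ws S(2) by blast
  have s2: "regs s2 r_one = 1" "regs s2 r_back = length Q * Suc (length es)"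
    using s1 by (simp_all add: s2_def run_reg insert_cmd_def insert_step_def descend_def graph_def)
  have run: "run (enqueue (of_bool n)) s =
      (if S \<in> set Q then s2 else effect (Move r_back r_cell) (effect (Inc r_cell) s2))"
    using ins(2) new s2 by (simp add: enqueue_def s2_def s1_def)
  have old: "arrs s2 a_queue (k * Suc (length es) + j) = of_bool (es ! j \<in> Q ! k)"
    if "k < length Q" "j < length es" for k j
    using that ins(4)[of "k * Suc (length es) + j"] s1(5,6) queue cell_less[OF that] by simp
  have word: "word es T \<in> set ws' \<longleftrightarrow> T \<in> set Q \<or> T = S" if "T \<subseteq> set es" for T
    using ws'(2) ws word_eq_iff[OF that S(2)] that by blast
  show ?thesis
  proof (cases "S \<in> set Q")
    case True
    have "\<forall>T. T \<subseteq> set es \<longrightarrow> word es T \<in> set ws' \<longleftrightarrow> T \<in> set Q" using word True by blast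
    then show ?thesis using True run Q ws'(1) s2 old by (auto simp: store_def)
  next
    case False
    let ?s = "effect (Move r_back r_cell) (effect (Inc r_cell) s2)"
    have "trie_state ws' ?s" using ws'(1) by (simp add: trie_state_def)
    moreover have "\<forall>T. T \<subseteq> set es \<longrightarrow> word es T \<in> set ws' \<longleftrightarrow> T \<in> set (Q @ [S])" using word by auto
    moreover have "regs ?s r_back = length (Q @ [S]) * Suc (length es)"
      using ins(3) s1(5) by simp
    moreover have "arrs ?s a_queue (k * Suc (length es) + j) = of_bool (es ! j \<in> (Q @ [S]) ! k)"
      if "k < length (Q @ [S])" "j < length es" for k j
      using that old[of k j] ins(5)[OF that(2)] s1(5) by (cases "k = length Q") (auto simp: nth_append)
    ultimately show ?thesis using False Q S(2) unfolding store_def run by auto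
  qed
qed

lemma run_enqueue_0:
  assumes "graph es s" "bits es (arrs s a_chosen) S" "S \<subseteq> set es" "store es Q s"
  shows "store es (if S \<in> set Q then Q else Q @ [S]) (run (enqueue 0) s)"
proof -
  obtain ws where "trie_state ws s" "\<forall>S. S \<subseteq> set es \<longrightarrow> word es S \<in> set ws \<longleftrightarrow> S \<in> set Q"
    using assms(4) by (auto simp: store_def)
  then show ?thesis
    using run_enqueue[OF assms(1-3), of Q ws False] assms(4) by (auto simp: store_def)
qed

definition pop_step :: cmd where
  "pop_step = Load r_x a_queue r_front ;; Store a_current r_j r_x ;;
     cmd_when (Equal r_x r_one) (Put r_j) ;; Inc r_front"

text \<open>The last increment skips the spare cell that ends each entry of the queue.\<close>

definition pop :: cmd where
  "pop = Loop r_j pop_step ;; EndSol ;; Inc r_front"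

lemma run_pop:
  assumes g: "graph es s" and Q: "store es Q s" and h: "h < length Q"
    "regs s r_front = h * Suc (length es)"
  shows "events pop s = emission es (Q ! h)"
    and "bits es (arrs (run pop s) a_current) (Q ! h)"
    and "regs (run pop s) r_front = Suc h * Suc (length es)"
proof -
  let ?I = "\<lambda>j ev t. ev = map Out (filter (\<lambda>j. es ! j \<in> Q ! h) [0..<j]) \<and>
    regs t r_front = h * Suc (length es) + j \<and>
    (\<forall>i < j. arrs t a_current i = of_bool (es ! i \<in> Q ! h))"
  have m: "regs s 0 = length es" using g by (simp add: graph_def)
  have "?I (regs s 0) (events (Loop r_j pop_step) s) (run (Loop r_j pop_step) s)"
  proof (rule Loop_invariant_events[where I = ?I], goal_cases)
    case 1
    show ?case by (simp add: pop_step_def)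
  next
    case 2
    show ?case using h by simp
  next
    case (3 j ev t)
    have "graph es t" using g by (rule graph_unchanged[OF _ 3(4)]) (auto simp: pop_step_def)
    moreover have "store es Q t" using Q by (rule store_unchanged[OF _ 3(4)]) (auto simp: pop_step_def)
    then have "\<forall>k < length Q. \<forall>j < length es.
        arrs t a_queue (k * Suc (length es) + j) = of_bool (es ! j \<in> Q ! k)"
      unfolding store_def by (elim conjE)
    then have "arrs t a_queue (h * Suc (length es) + j) = of_bool (es ! j \<in> Q ! h)"
      using 3(1) m h(1) by simp
    ultimately show ?case
      using 3(2,3) by (auto simp: pop_step_def graph_def less_Suc_eq)
  qed
  then show "events pop s = emission es (Q ! h)" "bits es (arrs (run pop s) a_current) (Q ! h)"
    "regs (run pop s) r_front = Suc h * Suc (length es)"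
    using m by (simp_all add: pop_def emission_def positions_def bits_def)
qed

section \<open>The search loop and its delay\<close>

definition body_cmd :: cmd where
  "body_cmd = pop ;; expand (enqueue 0)"

definition start_cmd :: cmd where
  "start_cmd = initial_cmd ;; enqueue 1"

definition list_prog :: prog where
  "list_prog = Seq (compile start_cmd) (While (Less r_front r_back) (compile body_cmd))"

lemma enqueue_frame:
  "written_regs (enqueue n) = {7, 8, 9, 18, 19, 20, 21, 23}"
  "written_arrs (enqueue n) = {10, 11, 12}"
  by (auto simp: enqueue_defs)

lemma silent_enqueue: "silent (enqueue n)"
  by (simp add: enqueue_defs)

lemma admissible_enqueue: "admissible (enqueue n)"
  by (simp add: enqueue_defs)

lemma admissible_expand_enqueue: "admissible (expand (enqueue n))"
  by (rule admissible_expand) (simp_all add: admissible_enqueue enqueue_frame)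

lemma run_expand_enqueue:
  assumes g: "graph es s" and es: "distinct es" and S: "bits es (arrs s a_current) S"
    and Q: "store es Q s"
  shows "\<exists>Xs. store es (Q @ Xs) (run (expand (enqueue 0)) s) \<and>
      set (Q @ Xs) = set Q \<union> neighbors es S"
proof -
  let ?J = "\<lambda>Ys (ev :: event list) t. \<exists>Xs. store es (Q @ Xs) t \<and> set (Q @ Xs) = set Q \<union> set Ys"
  have "?J (candidates es S (length es)) (events (expand (enqueue 0)) s) (run (expand (enqueue 0)) s)"
  proof (rule run_expand[OF g es S, where J = ?J])
    fix Ys ev b e t
    assume "?J Ys ev t" and gt: "graph es t" and e: "e \<in> set es"
      and b: "bits es (arrs (run (candidate_cmd b) t) a_chosen) (candidate es b e S)"
    then obtain Xs where Xs: "store es (Q @ Xs) t" "set (Q @ Xs) = set Q \<union> set Ys" by blast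
    let ?t = "run (candidate_cmd b) t" and ?X = "candidate es b e S"
    have "graph es ?t" using candidate_cmd_frame[of b] by (intro graph_run[OF gt]) auto
    moreover have "store es (Q @ Xs) ?t"
      using candidate_cmd_frame[of b] by (intro store_run[OF Xs(1)]) auto
    moreover have "?X \<subseteq> set es" by (intro maximal_connected_dags_subset candidate_maximal e)
    ultimately have "store es (if ?X \<in> set (Q @ Xs) then Q @ Xs else (Q @ Xs) @ [?X])
        (run (enqueue 0) ?t)"
      using b by (intro run_enqueue_0)
    then show "?J (Ys @ [?X]) (ev @ events (enqueue 0) ?t) (run (enqueue 0) ?t)"
      using Xs(2)
      by (intro exI[of _ "if ?X \<in> set (Q @ Xs) then Xs else Xs @ [?X]"]) (auto split: if_splits)
  next
    fix Ys ev t r v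
    assume "?J Ys ev t"
    then show "?J Ys ev (t\<lparr>regs := (regs t)(r_pivot := v)\<rparr>)"
      by (auto simp: store_def trie_state_def)
  qed (use Q admissible_expand_enqueue in \<open>auto simp: enqueue_frame intro: exI[of _ "[]"]\<close>)
  then show ?thesis by (simp add: set_candidates)
qed

text \<open>The queue is never shortened: \<open>Q\<close> holds every solution found, and the first
  \<open>h\<close> of them are expanded. For \<open>h = length Q\<close> the last clause says that
  \<open>Q\<close> is closed under neighbors.\<close>

definition searching :: "(nat \<times> nat) list \<Rightarrow> nat \<Rightarrow> (nat \<times> nat) set list \<Rightarrow> state \<Rightarrow> bool" where
  "searching es h Q s \<longleftrightarrow> graph es s \<and> store es Q s \<and> regs s r_front = h * Suc (length es) \<and>
    h \<le> length Q \<and> Q \<noteq> [] \<and> set Q \<subseteq> maximal_connected_dags (set es) \<and>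
    (\<forall>S \<in> set (take h Q). neighbors es S \<subseteq> set Q)"

lemma searching_body:
  assumes s: "searching es h Q s" and h: "h < length Q" and es: "distinct es"
  shows "events body_cmd s = emission es (Q ! h)"
    and "\<exists>Xs. searching es (Suc h) (Q @ Xs) (run body_cmd s)"
proof -
  have g: "graph es s" and Q: "store es Q s" and front: "regs s r_front = h * Suc (length es)"
    using s by (simp_all add: searching_def)
  note p = run_pop[OF g Q h front]
  have gp: "graph es (run pop s)" using g by (rule graph_run) (auto simp: pop_def pop_step_def)
  have Qp: "store es Q (run pop s)" using Q by (rule store_run) (auto simp: pop_def pop_step_def)
  have "silent (expand (enqueue 0))"
    by (simp add: expand_def silent_enqueue silent_candidate_cmd)
  then show "events body_cmd s = emission es (Q ! h)"
    using p(1) by (simp add: body_cmd_def silent_events)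
  obtain Xs where Xs: "store es (Q @ Xs) (run body_cmd s)"
    "set (Q @ Xs) = set Q \<union> neighbors es (Q ! h)"
    using run_expand_enqueue[OF gp es p(2) Qp] by (auto simp: body_cmd_def)
  have frame: "{0, 13, 14, 22} \<inter> written_regs (expand (enqueue 0)) = {}"
    "{0, 1} \<inter> written_arrs (expand (enqueue 0)) = {}"
    using candidate_cmd_frame[of True] candidate_cmd_frame[of False]
    by (auto simp: expand_def enqueue_frame)
  have "regs (run body_cmd s) r_front = Suc h * Suc (length es)"
    using p(3) frame by (simp add: body_cmd_def run_reg)
  moreover have "graph es (run body_cmd s)"
    using graph_run[OF gp, of "expand (enqueue 0)"] frame by (simp add: body_cmd_def)
  moreover have "set (Q @ Xs) \<subseteq> maximal_connected_dags (set es)"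
    using Xs(2) s neighbors_maximal unfolding searching_def by blast
  moreover have "neighbors es S \<subseteq> set (Q @ Xs)" if "S \<in> set (take (Suc h) (Q @ Xs))" for S
    using that h s Xs(2) by (auto simp: searching_def take_Suc_conv_app_nth)
  ultimately show "\<exists>Xs. searching es (Suc h) (Q @ Xs) (run body_cmd s)"
    using Xs h s unfolding searching_def by (intro exI[of _ Xs]) auto
qed

lemma start_searching:
  assumes es: "distinct es"
  defines "s \<equiv> init (input maximal_connected_dag_problem es)"
  shows "searching es 0 [initial_solution es] (run start_cmd s)" and "events start_cmd s = []"
proof -
  have loaded: "loaded es s" unfolding s_def by (rule loaded_init)
  note init = run_initial_cmd[OF loaded es]
  let ?s = "run initial_cmd s" and ?S = "initial_solution es"
  have frame: "{18, 19, 20, 21, 22, 23} \<inter> written_regs initial_cmd = {}"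
    "{10, 11, 12} \<inter> written_arrs initial_cmd = {}"
    by (simp_all add: initial_cmd_defs)
  have zero: "regs s r_fresh = 0" "regs s r_back = 0" "regs s r_front = 0" "arrs s a_left = (\<lambda>_. 0)"
    "arrs s a_right = (\<lambda>_. 0)"
    by (simp_all add: s_def init_def maximal_connected_dag_problem_def)
  then have zero': "regs ?s r_fresh = 0" "regs ?s r_back = 0" "regs ?s r_front = 0"
    "arrs ?s a_left = (\<lambda>_. 0)" "arrs ?s a_right = (\<lambda>_. 0)"
    using frame by (simp_all add: run_reg run_arr)
  then have "trie_state [[]] ?s"
    using trie_singleton by (simp add: trie_state_def if_distrib[of "arrs _"] cong: if_cong)
  moreover have max: "?S \<in> maximal_connected_dags (set es)" by (rule initial_solution_maximal)
  moreover have "T = ?S" if "T \<subseteq> set es" "word es T \<in> set [[]]" for T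
    using that maximal_connected_dags_subset[OF max] by (auto simp: word_def)
  ultimately have "store es [?S] (run (enqueue 1) ?s)"
    using run_enqueue[OF init maximal_connected_dags_subset[OF max], of "[]" "[[]]" True] zero'
    by simp
  moreover have "graph es (run (enqueue 1) ?s)"
    using init(1) by (rule graph_run) (auto simp: enqueue_frame)
  moreover have "regs (run (enqueue 1) ?s) r_front = 0"
    using zero' by (simp add: run_reg enqueue_frame)
  ultimately show "searching es 0 [?S] (run start_cmd s)"
    using max by (simp add: searching_def start_cmd_def)
  show "events start_cmd s = []"
    by (simp add: start_cmd_def silent_events silent_initial_cmd silent_enqueue)
qed

text \<open>A gap either ends within \<open>xs\<close> or is a gap of \<open>ys\<close> with a
  waiting time \<open>k\<close> carried across the boundary. A \<open>Sep\<close> in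
  \<open>xs\<close> makes the bound on \<open>k\<close> independent of \<open>n\<close>, which keeps
  the carry from accumulating over the rounds.\<close>

lemma gaps_append:
  assumes "g \<in> set (gaps n (xs @ ys))"
  shows "g \<le> n + length xs \<or>
    (\<exists>k \<le> (if Sep \<in> set xs then length xs else n + length xs). g \<in> set (gaps k ys))"
  using assms
proof (induction xs arbitrary: n)
  case Nil
  then show ?case by auto
next
  case (Cons x xs)
  show ?case
  proof (cases "x = Sep")
    case True
    then consider "g = Suc n" | "g \<in> set (gaps 0 (xs @ ys))" using Cons.prems by auto
    then show ?thesis
    proof cases
      case 2
      then show ?thesis using Cons.IH[OF 2] True by (auto split: if_splits intro: le_SucI)
    qed simp
  next
    case False
    then have "g \<in> set (gaps (Suc n) (xs @ ys))" using Cons.prems by (cases x) auto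
    then show ?thesis using Cons.IH[of "Suc n"] False by (auto split: if_splits intro: le_SucI)
  qed
qed

lemma gaps_no_Sep: "Sep \<notin> set xs \<Longrightarrow> gaps n (xs @ ys) = gaps (n + length xs) ys"
proof (induction xs arbitrary: n)
  case (Cons x xs)
  then show ?case by (cases x) auto
qed simp

lemma admissible_body_cmd: "admissible body_cmd"
  using admissible_expand_enqueue by (simp add: body_cmd_def pop_def pop_step_def)

text \<open>A round takes at most \<open>B\<close> steps including its test and contains a
  \<open>Sep\<close>. So at most \<open>B\<close> is carried into the next round, and a gap is at
  most a carry plus one round. The loop ends because \<open>h\<close> cannot exceed the finite
  number of solutions.\<close>

lemma exec_search:
  assumes "searching es h Q s" and es: "distinct es" and B: "Suc (cost (length es) body_cmd) \<le> B"
  shows "\<exists>tr t Xs. exec (While (Less r_front r_back) (compile body_cmd)) s tr t \<and>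
    filter (\<lambda>e. e \<noteq> Tick) tr = concat (map (emission es) (drop h (Q @ Xs))) \<and>
    distinct (Q @ Xs) \<and> set (Q @ Xs) = maximal_connected_dags (set es) \<and>
    (\<forall>n \<le> B. \<forall>g \<in> set (gaps n tr). g \<le> 2 * B)"
  using assms(1)
proof (induction "card (maximal_connected_dags (set es)) - h" arbitrary: h Q s rule: less_induct)
  case (less h Q s)
  let ?M = "maximal_connected_dags (set es)" and ?W = "While (Less r_front r_back) (compile body_cmd)"
  have s: "graph es s" "store es Q s" "regs s r_front = h * Suc (length es)" "h \<le> length Q" "Q \<noteq> []"
    "set Q \<subseteq> ?M" "\<forall>S \<in> set (take h Q). neighbors es S \<subseteq> set Q"
    using less.prems by (simp_all add: searching_def)
  have Q: "distinct Q" "regs s r_back = length Q * Suc (length es)" using s(2) by (simp_all add: store_def)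
  have test: "holds (Less r_front r_back) s \<longleftrightarrow> h < length Q" using s(3) Q(2) by (simp del: mult_Suc_right)
  show ?case
  proof (cases "h < length Q")
    case False
    then have "exec ?W s [Tick] s" using test by (intro exec.WhileFalse) simp
    moreover have "set Q = ?M"
      using s False by (intro neighbors_closed_complete) auto
    ultimately show ?thesis
      using False Q(1) B by (intro exI[of _ "[Tick]"] exI[of _ s] exI[of _ "[]"]) auto
  next
    case True
    obtain Ys where Ys: "searching es (Suc h) (Q @ Ys) (run body_cmd s)"
      using searching_body(2)[OF less.prems True es] by blast
    have "finite ?M" by (rule finite_subset[of _ "Pow (set es)"]) (auto simp: maximal_connected_dags_def)
    then have "length Q \<le> card ?M" using s(6) Q(1) by (metis card_mono distinct_card)
    then have "card ?M - Suc h < card ?M - h" using True by simp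
    from less.hyps[OF this Ys] obtain tr' t Xs where tr': "exec ?W (run body_cmd s) tr' t"
      "filter (\<lambda>e. e \<noteq> Tick) tr' = concat (map (emission es) (drop (Suc h) ((Q @ Ys) @ Xs)))"
      "distinct ((Q @ Ys) @ Xs)" "set ((Q @ Ys) @ Xs) = ?M"
      "\<forall>n \<le> B. \<forall>g \<in> set (gaps n tr'). g \<le> 2 * B" by blast
    have "regs s 0 = length es" using s(1) by (simp add: graph_def)
    from exec_compile[OF admissible_body_cmd this] obtain tr where
      tr: "exec (compile body_cmd) s tr (run body_cmd s)"
        "filter (\<lambda>e. e \<noteq> Tick) tr = emission es (Q ! h)" "length tr \<le> cost (length es) body_cmd"
      using searching_body(1)[OF less.prems True es] by auto
    have "exec ?W s (Tick # tr @ tr') t"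
      using True test tr(1) tr'(1) by (intro exec.WhileTrue) simp_all
    moreover have "drop h (Q @ Ys @ Xs) = Q ! h # drop (Suc h) (Q @ Ys @ Xs)"
      using True Cons_nth_drop_Suc[of h "Q @ Ys @ Xs"] by (simp add: nth_append)
    then have "filter (\<lambda>e. e \<noteq> Tick) (Tick # tr @ tr') =
        concat (map (emission es) (drop h (Q @ Ys @ Xs)))"
      using tr(2) tr'(2) by simp
    moreover have "g \<le> 2 * B" if ng: "n \<le> B" "g \<in> set (gaps n ((Tick # tr) @ tr'))" for n g
    proof -
      have "Sep \<in> set (filter (\<lambda>e. e \<noteq> Tick) tr)" unfolding tr(2) by (simp add: emission_def)
      then have sep: "Sep \<in> set (Tick # tr)" by simp
      have len: "length (Tick # tr) \<le> B" using tr(3) B by simp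
      from gaps_append[OF ng(2)] show ?thesis
        unfolding if_P[OF sep]
      proof (elim disjE exE conjE)
        assume "g \<le> n + length (Tick # tr)"
        then show ?thesis using ng(1) len by linarith
      next
        fix k assume "k \<le> length (Tick # tr)" "g \<in> set (gaps k tr')"
        then show ?thesis using tr'(5) len le_trans by blast
      qed
    qed
    ultimately show ?thesis
      using tr'(3,4) by (intro exI[of _ "Tick # tr @ tr'"] exI[of _ t] exI[of _ "Ys @ Xs"]) simp
  qed
qed

text \<open>The three levels are the pivot edges, the rounds of growing, and the passes over edges
  within one round.\<close>

lemma depth_list: "depth (start_cmd ;; body_cmd) = 3"
  by (simp add: start_cmd_def body_cmd_def initial_cmd_defs pop_def pop_step_def expand_def
      candidate_cmd_defs enqueue_defs)

lemma listable_with_delay: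
  "listable_with_delay maximal_connected_dag_problem (\<lambda>m. real m ^ 3)"
  unfolding listable_with_delay_def problem_simps
proof (intro exI[of _ list_prog] exI[of _ "\<lambda>n. 2 * Suc (cost n (start_cmd ;; body_cmd))"] conjI ballI)
  let ?c = "start_cmd ;; body_cmd"
  have pos: "0 < cost n ?c" for n by (simp add: start_cmd_def initial_cmd_def)
  \<comment> \<open>Since the cost is positive even without edges, the successor is absorbed into
    the constant factor.\<close>
  have "2 * Suc x \<le> 4 * x" if "0 < x" for x :: nat using that by simp
  from this[OF pos] have "2 * Suc (cost n ?c) \<le> 4 * cost n ?c" for n .
  then have "(\<lambda>n. real (2 * Suc (cost n ?c))) \<in> O(\<lambda>n. real (4 * cost n ?c))"
    by (intro landau_o.big_mono always_eventually allI) (simp only: real_norm_def abs_of_nat of_nat_le_iff)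
  also have "(\<lambda>n. real (4 * cost n ?c)) \<in> O(\<lambda>n. real n ^ 3)"
    using cost_bigo[of 4 ?c] unfolding depth_list .
  finally show "(\<lambda>n. real (2 * Suc (cost n ?c))) \<in> O(\<lambda>n. real n ^ 3)" .
next
  fix es :: "(nat \<times> nat) list" assume "es \<in> {es. distinct es}"
  then have es: "distinct es" by simp
  let ?s = "init (input maximal_connected_dag_problem es)"
  \<comment> \<open>A single bound for the start phase, which is carried into the first gap, and for
    every round of the search.\<close>
  let ?B = "Suc (cost (length es) (start_cmd ;; body_cmd))"
  note start = start_searching[OF es]
  have "regs ?s 0 = length es" using loaded_init(1)[of es] by (simp add: loaded_def)
  moreover have "admissible start_cmd"
    by (simp add: start_cmd_def admissible_enqueue) (simp add: initial_cmd_defs)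
  ultimately obtain tr where tr: "exec (compile start_cmd) ?s tr (run start_cmd ?s)"
    "filter (\<lambda>e. e \<noteq> Tick) tr = []" "length tr \<le> cost (length es) start_cmd"
    using exec_compile[of start_cmd ?s "length es"] start(2) by auto
  obtain tr' t Xs where tr': "exec (While (Less r_front r_back) (compile body_cmd)) (run start_cmd ?s) tr' t"
    "filter (\<lambda>e. e \<noteq> Tick) tr' = concat (map (emission es) ([initial_solution es] @ Xs))"
    "distinct ([initial_solution es] @ Xs)"
    "set ([initial_solution es] @ Xs) = maximal_connected_dags (set es)"
    "\<forall>n \<le> ?B. \<forall>g \<in> set (gaps n tr'). g \<le> 2 * ?B"
    using exec_search[OF start(1) es, of ?B] by auto
  let ?Q = "[initial_solution es] @ Xs"
  have "exec list_prog ?s (tr @ tr') t" unfolding list_prog_def by (rule exec.Seq[OF tr(1) tr'(1)])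
  moreover have "delay (tr @ tr') \<le> 2 * ?B"
  proof -
    \<comment> \<open>The start phase completes no output, so its whole length counts towards the
      first gap.\<close>
    have "Sep \<notin> set tr" using tr(2) by (auto simp: filter_empty_conv)
    then have "gaps 0 (tr @ tr') = gaps (length tr) tr'" by (simp add: gaps_no_Sep)
    moreover have "length tr \<le> ?B" using tr(3) by simp
    moreover have "gaps n xs \<noteq> []" for n xs by (induction n xs rule: gaps.induct) auto
    ultimately show ?thesis using tr'(5) by (simp add: delay_def)
  qed
  moreover have "outputs (tr @ tr') (map (positions es) ?Q)"
    using tr(2) tr'(2) by (intro outputs_emission) simp
  moreover have "list_all2 (encodes maximal_connected_dag_problem es) (map (positions es) ?Q) ?Q"
    using tr'(4) maximal_connected_dags_subset by (intro list_all2_encodes_positions) blast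
  ultimately show "\<exists>tr t xss Ss. exec list_prog ?s tr t \<and>
      delay tr \<le> 2 * Suc (cost (card (set es)) (start_cmd ;; body_cmd)) \<and> outputs tr xss \<and>
      list_all2 (encodes maximal_connected_dag_problem es) xss Ss \<and> distinct Ss \<and>
      set Ss = maximal_connected_dags (set es)"
    using tr'(3,4) unfolding distinct_card[OF es] by blast
qed

theorem theorem10p8:
  "proximity_searchable maximal_connected_dag_problem \<and>
   listable_with_delay maximal_connected_dag_problem (\<lambda>m. real m ^ 3)"
  using proximity_searchable listable_with_delay by blast

end
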